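(* Let $m\ge1$, $q=2^m$, $k=\mathbb F_q$, $k_2=\mathbb F_{q^2}$, $a\in k^*$, $b,c\in k$, and consider the curve $y^2+y=ax^5+bx^3+cx$, with notation as in the context. Then, according to the factorization type of $P(x)$ in $k[x]$: - $P$ irreducible: $w=0$, $\tilde w=0$, $\dim U/(k+\tilde W)=0$, $\operatorname{sgn}(\tilde Q)=+$; - $P=(1)(4)$ or $(2)(3)$: $w=1$, $\tilde w=2$, $\dim U/(k+\tilde W)=0$, $\operatorname{sgn}(\tilde Q)\in\{0,+\}$; - $P=(1)(1)(3)$: $w=2$, $\tilde w=2$, $\dim U/(k+\tilde W)=2$, $\operatorname{sgn}(\tilde Q)\in\{+,-\}$; - $P=(1)(2)(2)$: $w=2$, $\tilde w=4$, $\dim U/(k+\tilde W)=0$, $\operatorname{sgn}(\tilde Q)\in\{0,+\}$; - $P=(1)(1)(1)(2)$: $w=3$, $\tilde w=4$, $\dim U/(k+\tilde W)=2$, $\operatorname{sgn}(\tilde Q)\in\{0,+,-\}$; - $P=(1)(1)(1)(1)(1)$: $w=4$, $\tilde w=4$, $\dim U/(k+\tilde W)=4$, $\operatorname{sgn}(\tilde Q)\in\{+,-\}$. Moreover, let $Z\subseteq W$ be the set of roots of $P(x)$ in $k$. If $P=(1)(1)(3)$ or $P=(1)(1)(1)(2)$, then $\operatorname{sgn}(\tilde Q)=-$ iff $\ell_c(z)\neq\operatorname{Tr}(1)$ for all $z\in Z$. If $P=(1)(1)(1)(1)(1)$, then $\operatorname{sgn}(\tilde Q)=+$ iff $\ell_c(z)=0$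 for exactly $3$ of the $5$ roots $z\in Z$.
   Context: $P(x)=a^2x^5+b^2x+a$; $(n_1)\cdots(n_t)$ denotes factorization in $k[x]$ into $t$ irreducibles of degrees $n_1,\dots,n_t$. $E_{ab}(x)=a^4x^{16}+b^4x^8+b^2x^2+ax$; $W$, $\tilde W$ are its sets of roots in $k$, $k_2$, of $\mathbb F_2$-dimensions $w$, $\tilde w$. $\operatorname{Tr}$ is the absolute trace of $k$; $\ell_c\colon W\to\mathbb F_2$, $\ell_c(x)=\operatorname{Tr}((c+b^2a^{-1})x)$. $R(x)=ax^4+bx^2+c^2x$, $\langle x,y\rangle_R=\operatorname{Tr}_{k_2/\mathbb F_2}(xR(y)+yR(x))$, a symplectic form on $k_2$ with radical $\tilde W$. $U=\{u\in k_2:\langle u,\lambda\rangle_R=0\ \forall\lambda\in k\}\supseteq k+\tilde W$. $\tilde Q(x)=\operatorname{Tr}_{k_2/\mathbb F_2}(ax^5+bx^3+cx)$, linear on $\tilde W$ with kernel $\tilde V$. Define $\operatorname{sgn}(\tilde Q)=0$ if $\tilde V\ne\tilde W$; if $\tilde V=\tilde W$, $\tilde Q$ descends to a quadratic form on $k_2/\tilde W$ (dimension $2n$) with nondegenerate polar form, having either $2^{n-1}(2^n+1)$ zeros ($\operatorname{sgn}(\tilde Q)=+$) or $2^{n-1}(2^n-1)$ zeros ($\operatorname{sgn}(\tilde Q)=-$). *)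

theory Defs
  imports
    "HOL-Computational_Algebra.Computational_Algebra"
    "HOL-Library.Cardinality"
    "HOL-Library.Z2"
begin

definition field_embedding :: "('k::field \<Rightarrow> 'l::field) \<Rightarrow> bool" where
  "field_embedding h \<longleftrightarrow>
     h 1 = 1 \<and> (\<forall>x y. h (x + y) = h x + h y) \<and> (\<forall>x y. h (x * y) = h x * h y)"

text \<open>
  Absolute trace of a field with \<open>2 ^ d\<close> elements, as the sum of the conjugates. Its values lie
  in the prime field \<open>{0, 1}\<close>, which serves as \<open>\<bbbF>\<^sub>2\<close>.
\<close>
definition abs_trace :: "nat \<Rightarrow> 'a::field \<Rightarrow> 'a" where
  "abs_trace d x = (\<Sum>i<d. x ^ (2 ^ i))"


section \<open>Dimensions over the field with two elements\<close>

text \<open>In characteristic 2 this is the \<open>\<bbbF>\<^sub>2\<close>-vector space structure of a field.\<close>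
definition scale2 :: "bit \<Rightarrow> 'a::field \<Rightarrow> 'a" where
  "scale2 r x = (if r = 0 then 0 else x)"

abbreviation dim2 :: "'a::field set \<Rightarrow> nat" where
  "dim2 \<equiv> vector_space.dim scale2"

text \<open>The classes of the elements of \<open>B\<close> are distinct and form a basis of the quotient \<open>U / S\<close>.\<close>
definition quotient_basis2 :: "'a::{field,finite} set \<Rightarrow> 'a set \<Rightarrow> 'a set \<Rightarrow> bool" where
  "quotient_basis2 U S B \<longleftrightarrow>
     B \<subseteq> U \<and>
     (\<forall>r. (\<Sum>x\<in>B. scale2 (r x) x) \<in> S \<longrightarrow> (\<forall>x\<in>B. r x = 0)) \<and>
     module.span scale2 (B \<union> S) = U"

definition quotient_dim2 :: "'a::{field,finite} set \<Rightarrow> 'a set \<Rightarrow> nat" where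
  "quotient_dim2 U S = (THE d. \<exists>B. quotient_basis2 U S B \<and> card B = d)"


section \<open>The polynomials \<open>P\<close> and \<open>E\<close>\<close>

definition P_poly :: "'k::field \<Rightarrow> 'k \<Rightarrow> 'k poly" where
  "P_poly a b = monom (a^2) 5 + monom (b^2) 1 + [:a:]"

text \<open>The leading coefficient may be absorbed into any of the irreducible factors.\<close>
definition has_factor_type :: "'k::field poly \<Rightarrow> nat multiset \<Rightarrow> bool" where
  "has_factor_type p ns \<longleftrightarrow>
     (\<exists>F. (\<forall>f\<in>#F. irreducible f) \<and> prod_mset F = p \<and> image_mset degree F = ns)"

text \<open>The root set is \<open>W\<close> for \<open>a, b\<close> in \<open>k\<close>, and \<open>\<tilde>W\<close> for their images in \<open>k\<^sub>2\<close>.\<close>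
definition E_roots :: "'a::field \<Rightarrow> 'a \<Rightarrow> 'a set" where
  "E_roots a b = {x. a^4 * x^16 + b^4 * x^8 + b^2 * x^2 + a * x = 0}"

definition ell :: "nat \<Rightarrow> 'k::field \<Rightarrow> 'k \<Rightarrow> 'k \<Rightarrow> 'k \<Rightarrow> 'k" where
  "ell m a b c x = abs_trace m ((c + b^2 * inverse a) * x)"


section \<open>The quadratic form on the quadratic extension\<close>

text \<open>
  In this section \<open>a, b, c\<close> are elements of the field \<open>k\<^sub>2\<close> with \<open>2 ^ (2 * m)\<close> elements, except in
  \<open>U_space\<close>, which takes elements of \<open>k\<close> and the embedding \<open>h\<close> of \<open>k\<close> into \<open>k\<^sub>2\<close>.
\<close>

definition R_map :: "'l::field \<Rightarrow> 'l \<Rightarrow> 'l \<Rightarrow> 'l \<Rightarrow> 'l" where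
  "R_map a b c x = a * x^4 + b * x^2 + c^2 * x"

definition R_form :: "nat \<Rightarrow> 'l::field \<Rightarrow> 'l \<Rightarrow> 'l \<Rightarrow> 'l \<Rightarrow> 'l \<Rightarrow> 'l" where
  "R_form m a b c x y = abs_trace (2 * m) (x * R_map a b c y + y * R_map a b c x)"

definition U_space :: "('k::field \<Rightarrow> 'l::field) \<Rightarrow> nat \<Rightarrow> 'k \<Rightarrow> 'k \<Rightarrow> 'k \<Rightarrow> 'l set" where
  "U_space h m a b c = {u. \<forall>l. R_form m (h a) (h b) (h c) u (h l) = 0}"

definition Q_form :: "nat \<Rightarrow> 'l::field \<Rightarrow> 'l \<Rightarrow> 'l \<Rightarrow> 'l \<Rightarrow> 'l" where
  "Q_form m a b c x = abs_trace (2 * m) (a * x^5 + b * x^3 + c * x)"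

definition V_space :: "nat \<Rightarrow> 'l::field \<Rightarrow> 'l \<Rightarrow> 'l \<Rightarrow> 'l set" where
  "V_space m a b c = {x \<in> E_roots a b. Q_form m a b c x = 0}"

text \<open>Number of zeros of the form induced by \<open>Q_form\<close> on the space of cosets of \<open>\<tilde>W\<close>.\<close>
definition Q_zeros :: "nat \<Rightarrow> 'l::{field,finite} \<Rightarrow> 'l \<Rightarrow> 'l \<Rightarrow> nat" where
  "Q_zeros m a b c =
     card {C \<in> UNIV // {(x, y). x - y \<in> E_roots a b}. \<forall>x\<in>C. Q_form m a b c x = 0}"

text \<open>
  The signs \<open>+\<close> and \<open>-\<close> are encoded as \<open>1\<close> and \<open>-1\<close>. The zero counts
  \<open>2 ^ (n - 1) * (2 ^ n + 1)\<close> and \<open>2 ^ (n - 1) * (2 ^ n - 1)\<close> are multiplied by 2 because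
  \<open>n = 0\<close> is possible. That one of the two occurs is not built in: the value is otherwise
  unspecified.
\<close>
definition Q_sgn :: "nat \<Rightarrow> 'l::{field,finite} \<Rightarrow> 'l \<Rightarrow> 'l \<Rightarrow> int" where
  "Q_sgn m a b c =
     (if V_space m a b c \<noteq> E_roots a b then 0
      else if \<exists>n. quotient_dim2 UNIV (E_roots a b) = 2 * n \<and>
                  2 * Q_zeros m a b c = 2 ^ n * (2 ^ n + 1) then 1
      else if \<exists>n. quotient_dim2 UNIV (E_roots a b) = 2 * n \<and>
                  2 * Q_zeros m a b c = 2 ^ n * (2 ^ n - 1) then -1
      else undefined)"

end

theory Submission
  imports Defs
begin

text \<open>
  Let \<open>S\<close> be the sum of \<open>(-1)\<close> to the power \<open>\<tilde>Q(x)\<close> over \<open>x \<in> k\<^sub>2\<close>. Squaring it gives \<open>S\<^sup>2 = q\<^sup>2 |\<tilde>W|\<close> if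
  \<open>\<tilde>Q\<close> vanishes on \<open>\<tilde>W\<close> and \<open>S = 0\<close> otherwise, and \<open>sgn(\<tilde>Q)\<close> is the sign of \<open>S\<close>. Writing
  \<open>k\<^sub>2 = k + k u\<close> with \<open>u + u\<^sup>q = 1\<close> and summing over the cosets of \<open>k\<close>, which works because \<open>\<tilde>Q\<close>
  vanishes on \<open>k\<close>, only the cosets of \<open>w u\<close> with \<open>w \<in> W\<close> survive. There \<open>\<tilde>Q(w u)\<close> equals \<open>Tr(a w\<^sup>5 + b w\<^sup>3 + c w)\<close>
  plus \<open>w\<^sup>5 P(w)\<close>, which is \<open>0\<close> or \<open>1\<close> because \<open>E = x P (1 + x\<^sup>5 P)\<close>. So \<open>S / q\<close> is a signed sum over \<open>W\<close>
  of an additive character. The roots of \<open>1 + x\<^sup>5 P\<close> are the linear coefficients of the monic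
  quadratic divisors of \<open>P\<close>, hence \<open>W\<close> is read off from the factorization type, and \<open>S / q\<close> depends
  only on the character values at the roots and at the coefficients of the irreducible quadratic
  factors. As \<open>S\<close> is nonzero for some \<open>c\<close>, its possible values also determine \<open>|\<tilde>W|\<close>. Finally
  \<open>U\<close> is the preimage of \<open>W\<close> under the trace \<open>k\<^sub>2 \<rightarrow> k\<close>, so the dimension of \<open>U / (k + \<tilde>W)\<close> is \<open>2 w - \<tilde>w\<close>.
\<close>

section \<open>Characters and quadratic forms in characteristic 2\<close>

lemma char2_arith:
  fixes x :: "'a::ring_1"
  assumes "(2::'a) = 0"
  shows "x + x = 0" "- x = x" "x - y = x + y"
proof -
  show 1: "x + x = 0"
    by (metis assms mult_2 mult_zero_left)
  then show 2: "- x = x" by (simp add: add_eq_0_iff)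
  have "y + y = 0" by (metis assms mult_2 mult_zero_left)
  then show "x - y = x + y" by (metis add_diff_cancel_left' add.right_neutral add_diff_eq)
qed

text \<open>Meant for traces, which take the values 0 and 1 inside the field; there it is the
  character \<open>(-1)^x\<close>.\<close>

definition chi :: "'a::zero \<Rightarrow> int" where
  "chi x = (if x = 0 then 1 else -1)"

lemma chi_0 [simp]: "chi 0 = 1" and chi_1 [simp]: "chi (1::'a::zero_neq_one) = -1"
  by (auto simp: chi_def)

lemma chi_cases: "chi x = 1 \<or> chi x = -1"
  by (auto simp: chi_def)

text \<open>In characteristic 2 closure under negation is automatic.\<close>
definition additive_subgroup :: "'a::comm_monoid_add set \<Rightarrow> bool" where
  "additive_subgroup G \<longleftrightarrow> 0 \<in> G \<and> (\<forall>x\<in>G. \<forall>y\<in>G. x + y \<in> G)"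

lemma card_bit: "CARD(bit) = 2"
proof -
  have "(UNIV :: bit set) = {0, 1}" using bit_not_one_iff by auto
  then have "CARD(bit) = card {0, 1 :: bit}" by (rule arg_cong)
  then show ?thesis by (simp only: card_2_iff') auto
qed

section \<open>Finite fields of order \<open>2 ^ d\<close>: Frobenius map, absolute trace and
  character sums\<close>

locale binary_field =
  fixes F :: "'a::{field,finite} itself" and d :: nat
  assumes card_field: "CARD('a) = 2 ^ d"
begin

text \<open>Translation by 1 permutes the field, so comparing the sum of all elements with its
  translate kills the image of the cardinality, a power of 2.\<close>

lemma two_eq_0: "(2::'a) = 0"
proof -
  have "(\<Sum>x\<in>UNIV. x) = (\<Sum>x\<in>UNIV. x + (1::'a))"
    by (rule sum.reindex_bij_witness[of _ "\<lambda>x. x + 1" "\<lambda>x. x - 1"]) auto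
  also have "\<dots> = (\<Sum>x\<in>UNIV. x) + of_nat (CARD('a))"
    by (simp add: sum.distrib)
  finally have "of_nat (2 ^ d) = (0::'a)" unfolding card_field by simp
  then show ?thesis by simp
qed

lemmas add_self = char2_arith(1)[OF two_eq_0]
lemmas uminus_eq = char2_arith(2)[OF two_eq_0]
lemmas minus_eq = char2_arith(3)[OF two_eq_0]

lemma numeral_Bit0_eq: "(numeral (num.Bit0 n) :: 'a) = 0"
  by (metis mult_2 mult_zero_left numeral_Bit0 two_eq_0)

lemma add_eq_0_iff: "x + y = 0 \<longleftrightarrow> x = (y::'a)"
  by (metis minus_eq right_minus_eq)

lemma add_self_left: "x + (x + y) = (y::'a)"
  by (simp add: add_self flip: add.assoc)

lemma dim_pos: "d > 0"
proof (rule ccontr)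
  assume "\<not> d > 0"
  then have "CARD('a) = 1" using card_field by simp
  then show False by (metis card_1_singletonE UNIV_I singletonD zero_neq_one)
qed

text \<open>Multiplication by a nonzero \<open>x\<close> permutes the nonzero elements. An extra
  factor \<open>x\<close> is carried along to reach the exponent \<open>2 ^ d\<close>, so that the
  identity also covers 0.\<close>

lemma fermat: "(x::'a) ^ 2 ^ d = x"
proof (cases "x = 0")
  case False
  have "x * (\<Prod>y\<in>UNIV-{0}. x * y) = x * x ^ (2 ^ d - 1) * \<Prod>(UNIV-{0})"
    by (simp add: prod.distrib mult_ac card_field)
  also have "x * x ^ (2 ^ d - 1) = x ^ 2 ^ d"
    by (simp flip: power_Suc)
  also have "(\<Prod>y\<in>UNIV-{0}. x * y) = (\<Prod>y\<in>UNIV-{0}. y)"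
    by (rule prod.reindex_bij_witness[of _ "\<lambda>y. y / x" "\<lambda>y. x * y"]) (use False in auto)
  finally show ?thesis
    by simp
qed (simp add: power_0_left)

lemma square_add: "(x + y :: 'a)\<^sup>2 = x\<^sup>2 + y\<^sup>2"
  by (simp add: power2_sum two_eq_0)

lemma frobenius_add: "(x + y :: 'a) ^ 2 ^ i = x ^ 2 ^ i + y ^ 2 ^ i"
proof (induction i)
  case (Suc i)
  have "(x + y) ^ 2 ^ Suc i = ((x + y) ^ 2 ^ i)\<^sup>2"
    by (simp add: mult.commute flip: power_mult)
  then show ?case
    by (simp add: Suc square_add mult.commute flip: power_mult)
qed simp

lemma frobenius_add_explicit:
  "(x + y :: 'a) ^ 4 = x ^ 4 + y ^ 4"
  "(x + y :: 'a) ^ 8 = x ^ 8 + y ^ 8"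
  "(x + y :: 'a) ^ 16 = x ^ 16 + y ^ 16"
  using frobenius_add[of x y 2] frobenius_add[of x y 3] frobenius_add[of x y 4] by simp_all

lemma frobenius_inj: "inj (\<lambda>x::'a. x ^ 2 ^ i)"
proof (rule injI)
  fix x y :: 'a
  assume "x ^ 2 ^ i = y ^ 2 ^ i"
  then have "(x + y) ^ 2 ^ i = 0" by (simp only: frobenius_add add_self)
  then show "x = y" by (simp add: add_eq_0_iff)
qed

lemma frobenius_bij: "bij (\<lambda>x::'a. x ^ 2 ^ i)"
  using frobenius_inj by (simp add: bij_def finite_UNIV_inj_surj)

lemma square_sum: "(\<Sum>i\<in>A. f i :: 'a)\<^sup>2 = (\<Sum>i\<in>A. (f i)\<^sup>2)"
  by (induction A rule: infinite_finite_induct) (auto simp: square_add)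

abbreviation tr :: "'a \<Rightarrow> 'a" where
  "tr \<equiv> abs_trace d"

lemma tr_add: "tr (x + y) = tr x + tr y"
  by (simp add: abs_trace_def frobenius_add sum.distrib)

lemma tr_0 [simp]: "tr 0 = 0"
  by (simp add: abs_trace_def power_0_left)

lemma square_tr: "(tr x)\<^sup>2 = tr x"
proof -
  have "(tr x)\<^sup>2 = (\<Sum>i<d. x ^ 2 ^ Suc i)"
    by (simp add: abs_trace_def square_sum mult.commute flip: power_mult)
  \<comment> \<open>Adding \<open>x\<close> completes the shifted sum to one over
    \<open>Suc d\<close> conjugates, whose top term is \<open>x\<close> again by
    \<open>fermat\<close>.\<close>
  also have "\<dots> + x = (\<Sum>i<Suc d. x ^ 2 ^ i)"
    by (subst sum.lessThan_Suc_shift) simp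
  also have "\<dots> = tr x + x" by (simp add: abs_trace_def fermat)
  finally show ?thesis by simp
qed

lemma tr_square: "tr (x\<^sup>2) = tr x"
proof -
  have "tr (x\<^sup>2) = (tr x)\<^sup>2"
    by (simp add: abs_trace_def square_sum mult.commute flip: power_mult)
  then show ?thesis by (simp add: square_tr)
qed

lemma tr_power4: "tr (x ^ 4) = tr x"
  using tr_square[of "x\<^sup>2"] by (simp add: tr_square)

lemma tr_range: "tr x \<in> {0, 1}"
  using square_tr[of x] by (simp add: power2_eq_square)

text \<open>The trace is evaluation of a nonzero polynomial of degree at most
  \<open>2 ^ (d - 1)\<close>, which has too few roots to vanish on the whole field.\<close>

lemma tr_nonzero: "\<exists>x::'a. tr x = 1"
proof -
  define p :: "'a poly" where "p = (\<Sum>i<d. monom 1 (2 ^ i))"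
  have "coeff p 1 = (\<Sum>i<d. if i = 0 then 1 else 0)"
    unfolding p_def coeff_sum by (intro sum.cong) auto
  then have "coeff p 1 = 1" using dim_pos by simp
  then have "p \<noteq> 0" by auto
  have "degree p \<le> 2 ^ (d - 1)"
    unfolding p_def by (intro degree_sum_le) (auto simp: degree_monom_eq)
  then have "card {x. poly p x = 0} \<le> 2 ^ (d - 1)"
    using card_poly_roots_bound[OF \<open>p \<noteq> 0\<close>] by linarith
  also have "\<dots> < CARD('a)" using dim_pos by (simp add: card_field)
  finally have "{x. poly p x = 0} \<noteq> UNIV" by auto
  then obtain x where "poly p x \<noteq> 0" by auto
  moreover have "poly p x = tr x"
    by (simp add: p_def abs_trace_def poly_sum poly_monom)
  ultimately show ?thesis using tr_range[of x] by auto
qed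

lemma chi_add: "x \<in> {0, 1} \<Longrightarrow> y \<in> {0, 1} \<Longrightarrow> chi (x + y :: 'a) = chi x * chi y"
  by (auto simp: add_self)

lemma chi_tr_add: "chi (tr (x + y)) = chi (tr x) * chi (tr y)"
  unfolding tr_add by (intro chi_add tr_range)

text \<open>Orthogonality of characters: translation by some \<open>g\<close> in \<open>G\<close>
  with \<open>f g = 1\<close> permutes \<open>G\<close> and flips every sign.\<close>

lemma sum_chi:
  fixes f :: "'b::{ab_group_add,finite} \<Rightarrow> 'a"
  assumes G: "additive_subgroup G"
    and f: "\<And>x. x \<in> G \<Longrightarrow> f x \<in> {0, 1}"
      "\<And>x y. x \<in> G \<Longrightarrow> y \<in> G \<Longrightarrow> f (x + y) = f x + f y"
  shows "(\<Sum>x\<in>G. chi (f x)) = (if \<forall>x\<in>G. f x = 0 then int (card G) else 0)"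
proof (cases "\<forall>x\<in>G. f x = 0")
  case False
  then obtain g where g: "g \<in> G" "f g = 1" using f(1) by blast
  have inj: "inj_on (\<lambda>x. x + g) G" by (auto intro: inj_onI)
  have "(\<lambda>x. x + g) ` G = G"
    using G g by (intro endo_inj_surj inj) (auto simp: additive_subgroup_def)
  then have "(\<Sum>x\<in>G. chi (f x)) = (\<Sum>x\<in>G. chi (f (x + g)))"
    using sum.reindex[OF inj, of "\<lambda>x. chi (f x)"] by simp
  also have "\<dots> = (\<Sum>x\<in>G. - chi (f x))"
    by (intro sum.cong refl) (subst f(2), use g f chi_add in auto)
  finally have "(\<Sum>x\<in>G. chi (f x)) = 0" by (simp add: sum_negf)
  then show ?thesis using False by argo
qed simp

lemma sum_chi_tr:
  "(\<Sum>x\<in>UNIV. chi (tr (y * x))) = (if y = 0 then 2 ^ d else 0)"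
proof -
  have *: "(\<Sum>x\<in>UNIV. chi (tr (y * x))) =
      (if \<forall>x\<in>UNIV. tr (y * x) = 0 then int (card (UNIV::'a set)) else 0)"
    by (rule sum_chi) (use tr_range in \<open>auto simp: additive_subgroup_def distrib_left tr_add\<close>)
  show ?thesis
  proof (cases "y = 0")
    case False
    obtain x where "tr x = 1" using tr_nonzero by blast
    then have "tr (y * (x / y)) \<noteq> 0" using False by simp
    then have "\<exists>x. tr (y * x) \<noteq> 0" by blast
    then show ?thesis using * False by auto
  qed (simp add: card_field)
qed

section \<open>The quadratic form, its polar form and its exponential sum\<close>

definition E_map :: "'a \<Rightarrow> 'a \<Rightarrow> 'a \<Rightarrow> 'a" where
  "E_map a b x = a ^ 4 * x ^ 16 + b ^ 4 * x ^ 8 + b\<^sup>2 * x\<^sup>2 + a * x"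

lemma E_roots_iff: "x \<in> E_roots a b \<longleftrightarrow> E_map a b x = 0"
  by (simp add: E_roots_def E_map_def)

lemma E_map_0 [simp]: "E_map a b 0 = 0"
  by (simp add: E_map_def)

lemma E_map_add: "E_map a b (x + y) = E_map a b x + E_map a b y"
  by (simp add: E_map_def frobenius_add_explicit square_add algebra_simps)

lemma additive_subgroup_E_roots: "additive_subgroup (E_roots a b :: 'a set)"
  by (simp add: additive_subgroup_def E_roots_iff E_map_add)

definition Q_map :: "'a \<Rightarrow> 'a \<Rightarrow> 'a \<Rightarrow> 'a \<Rightarrow> 'a" where
  "Q_map a b c x = tr (a * x ^ 5 + b * x ^ 3 + c * x)"

lemma Q_map_range: "Q_map a b c x \<in> {0, 1}"
  unfolding Q_map_def by (rule tr_range)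

lemma Q_map_0 [simp]: "Q_map a b c 0 = 0"
  by (simp add: Q_map_def)

text \<open>The right side is the polar form of \<open>Q_map\<close>. Since the trace is invariant
  under squaring, each term can be raised to a power that makes \<open>y ^ 4\<close> its only power
  of \<open>y\<close>; hence the radical is the kernel of \<open>E_map\<close>.\<close>

lemma tr_E_map:
  "tr (y ^ 4 * E_map a b x) = tr (a * (x ^ 4 * y + x * y ^ 4) + b * (x\<^sup>2 * y + x * y\<^sup>2))"
proof -
  have 1: "tr (y ^ 4 * (a ^ 4 * x ^ 16)) = tr (a * x ^ 4 * y)"
    using tr_power4[of "a * x ^ 4 * y"] by (simp add: power_mult_distrib mult_ac flip: power_mult)
  have 2: "tr (y ^ 4 * (b ^ 4 * x ^ 8)) = tr (b * x\<^sup>2 * y)"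
    using tr_power4[of "b * x ^ 2 * y"] by (simp add: power_mult_distrib mult_ac flip: power_mult)
  have 3: "tr (y ^ 4 * (b\<^sup>2 * x\<^sup>2)) = tr (b * x * y\<^sup>2)"
    using tr_square[of "b * x * y\<^sup>2"] by (simp add: power_mult_distrib mult_ac flip: power_mult)
  have "tr (y ^ 4 * E_map a b x) =
      tr (y ^ 4 * (a ^ 4 * x ^ 16)) + tr (y ^ 4 * (b ^ 4 * x ^ 8)) +
      tr (y ^ 4 * (b\<^sup>2 * x\<^sup>2)) + tr (y ^ 4 * (a * x))"
    unfolding E_map_def distrib_left tr_add ..
  also have "\<dots> = tr (a * (x ^ 4 * y + x * y ^ 4) + b * (x\<^sup>2 * y + x * y\<^sup>2))"
    unfolding 1 2 3 tr_add[symmetric] by (simp add: algebra_simps)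
  finally show ?thesis .
qed

lemma power_add_expand:
  fixes x y :: 'a
  shows "(x + y) ^ 3 = x ^ 3 + y ^ 3 + (x\<^sup>2 * y + x * y\<^sup>2)"
    and "(x + y) ^ 5 = x ^ 5 + y ^ 5 + (x ^ 4 * y + x * y ^ 4)"
proof -
  have "(x + y) ^ 3 = (x + y)\<^sup>2 * (x + y)" by (simp add: power3_eq_cube power2_eq_square)
  then show "(x + y) ^ 3 = x ^ 3 + y ^ 3 + (x\<^sup>2 * y + x * y\<^sup>2)"
    unfolding square_add by (simp add: algebra_simps power3_eq_cube power2_eq_square)
  have "(x + y) ^ 5 = (x + y) ^ 4 * (x + y)"
    by (simp flip: power_Suc2)
  then show "(x + y) ^ 5 = x ^ 5 + y ^ 5 + (x ^ 4 * y + x * y ^ 4)"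
    unfolding frobenius_add_explicit by (simp add: algebra_simps eval_nat_numeral)
qed

lemma Q_map_add:
  "Q_map a b c (x + y) = Q_map a b c x + Q_map a b c y + tr (y ^ 4 * E_map a b x)"
  unfolding tr_E_map Q_map_def power_add_expand tr_add[symmetric]
  by (simp add: algebra_simps)

lemma chi_Q_map_add:
  "chi (Q_map a b c (x + y)) =
     chi (Q_map a b c x) * chi (Q_map a b c y) * chi (tr (y ^ 4 * E_map a b x))"
proof -
  have "chi (Q_map a b c (x + y)) = chi (tr ((a * x ^ 5 + b * x ^ 3 + c * x) +
      (a * y ^ 5 + b * y ^ 3 + c * y) + y ^ 4 * E_map a b x))"
    unfolding Q_map_add by (simp add: Q_map_def tr_add)
  then show ?thesis unfolding Q_map_def
    by (simp only: chi_tr_add[of "(a * x ^ 5 + b * x ^ 3 + c * x) + (a * y ^ 5 + b * y ^ 3 + c * y)"]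
        chi_tr_add[of "a * x ^ 5 + b * x ^ 3 + c * x" "a * y ^ 5 + b * y ^ 3 + c * y"])
qed

lemma Q_map_add_E_roots:
  "x \<in> E_roots a b \<Longrightarrow> Q_map a b c (x + y) = Q_map a b c x + Q_map a b c y"
  by (simp add: Q_map_add E_roots_iff)

text \<open>Fourth powers run through the whole field, so the factor \<open>y ^ 4\<close> in
  \<open>tr_E_map\<close> does not disturb orthogonality.\<close>

lemma sum_chi_tr_power4:
  "(\<Sum>x\<in>UNIV. chi (tr (x ^ 4 * y))) = (if y = 0 then 2 ^ d else 0)"
proof -
  have "(\<Sum>x\<in>UNIV. chi (tr (x ^ 4 * y))) = (\<Sum>x\<in>UNIV. chi (tr (y * x)))"
    using sum.reindex_bij_betw[OF frobenius_bij[of 2], of "\<lambda>x. chi (tr (y * x))"]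
    by (simp add: mult.commute)
  then show ?thesis by (simp add: sum_chi_tr)
qed

text \<open>The sum \<open>S\<close> of the overview, formed over any field of order
  \<open>2 ^ d\<close>.\<close>

definition gauss :: "'a \<Rightarrow> 'a \<Rightarrow> 'a \<Rightarrow> int" where
  "gauss a b c = (\<Sum>x\<in>UNIV. chi (Q_map a b c x))"

lemma sum_UNIV_add: "(\<Sum>x\<in>UNIV. f (x + y :: 'a)) = (\<Sum>x\<in>UNIV. f x)"
  by (rule sum.reindex_bij_witness[of _ "\<lambda>x. x - y" "\<lambda>x. x + y"]) auto

lemma chi_mult_self: "chi x * chi x = 1"
  by (simp add: chi_def)

text \<open>Shifting the second variable by the first leaves a sum of the polar form. Summing it
  over one variable concentrates the other on the radical, where \<open>Q_map\<close> is additive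
  and \<open>sum_chi\<close> applies.\<close>

lemma gauss_square:
  "(gauss a b c)\<^sup>2 =
     (if \<forall>x\<in>E_roots a b. Q_map a b c x = 0 then 2 ^ d * int (card (E_roots a b :: 'a set)) else 0)"
proof -
  let ?f = "\<lambda>x. chi (Q_map a b c x)"
  have "(gauss a b c)\<^sup>2 = (\<Sum>x\<in>UNIV. \<Sum>y\<in>UNIV. ?f x * ?f y)"
    by (simp add: gauss_def power2_eq_square sum_product)
  also have "\<dots> = (\<Sum>x\<in>UNIV. \<Sum>y\<in>UNIV. ?f x * ?f (y + x))"
    by (intro sum.cong refl sum_UNIV_add[symmetric])
  also have "\<dots> = (\<Sum>x\<in>UNIV. \<Sum>y\<in>UNIV. ?f y * chi (tr (x ^ 4 * E_map a b y)))"
    by (intro sum.cong refl)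
      (simp add: chi_Q_map_add mult.left_commute[of "?f x" for x] mult.assoc[symmetric] chi_mult_self)
  also have "\<dots> = (\<Sum>y\<in>UNIV. ?f y * (\<Sum>x\<in>UNIV. chi (tr (x ^ 4 * E_map a b y))))"
    by (subst sum.swap) (simp add: sum_distrib_left)
  also have "\<dots> = (\<Sum>y\<in>UNIV. if y \<in> E_roots a b then 2 ^ d * ?f y else 0)"
    by (intro sum.cong refl) (simp add: sum_chi_tr_power4 E_roots_iff)
  also have "\<dots> = 2 ^ d * (\<Sum>y\<in>E_roots a b. ?f y)"
    by (simp add: sum.If_cases sum_distrib_left)
  also have "(\<Sum>y\<in>E_roots a b. ?f y) =
      (if \<forall>x\<in>E_roots a b. Q_map a b c x = 0 then int (card (E_roots a b :: 'a set)) else 0)"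
    by (rule sum_chi[OF additive_subgroup_E_roots Q_map_range Q_map_add_E_roots])
  finally show ?thesis by simp
qed

text \<open>Squaring \<open>p\<close> produces no cross terms, and the two terms
  \<open>a^2 y^6\<close>, one from \<open>y p\<close> and one from \<open>y^6 p^2\<close>,
  cancel.\<close>

lemma E_map_factor:
  fixes a b y :: 'a
  defines "p \<equiv> a\<^sup>2 * y ^ 5 + b\<^sup>2 * y + a"
  shows "E_map a b y = y * p * (1 + y ^ 5 * p)"
proof -
  have "p\<^sup>2 = a ^ 4 * y ^ 10 + b ^ 4 * y\<^sup>2 + a\<^sup>2"
    by (simp add: p_def square_add power_mult_distrib flip: power_mult)
  moreover have "y * p * (1 + y ^ 5 * p) = y * p + y ^ 6 * p\<^sup>2"
    by (simp add: algebra_simps power2_eq_square eval_nat_numeral)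
  ultimately have "y * p * (1 + y ^ 5 * p) = y * p + y ^ 6 * (a ^ 4 * y ^ 10 + b ^ 4 * y\<^sup>2 + a\<^sup>2)"
    by simp
  also have "\<dots> = E_map a b y + (a\<^sup>2 * y ^ 6 + a\<^sup>2 * y ^ 6)"
    unfolding p_def E_map_def by (simp add: algebra_simps eval_nat_numeral)
  finally show ?thesis by (simp add: add_self)
qed

lemma Q_map_linear: "Q_map a b c x = Q_map a b 0 x + tr (c * x)"
  by (simp add: Q_map_def tr_add)

text \<open>If the form vanishes on its radical, it is constant on the cosets, so its zero set is a
  disjoint union of cosets of equal size. This links the coset count in \<open>Q_zeros\<close> to
  the point count in \<open>gauss_eq_card\<close>.\<close>

lemma Q_zeros_cosets:
  assumes "\<forall>w\<in>E_roots a b. Q_map a b c w = (0::'a)"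
  shows "card {C \<in> UNIV // {(x, y). x - y \<in> E_roots a b}. \<forall>x\<in>C. Q_map a b c x = 0} *
     card (E_roots a b :: 'a set) = card {x. Q_map a b c x = 0}"
proof -
  let ?W = "E_roots a b :: 'a set" and ?Q = "Q_map a b c"
  let ?R = "{(x, y). x - y \<in> ?W}"
  let ?CC = "{C \<in> UNIV // ?R. \<forall>x\<in>C. ?Q x = 0}"
  have W: "additive_subgroup ?W" by (rule additive_subgroup_E_roots)
  have equiv: "equiv UNIV ?R"
  proof (rule equivI)
    show "refl ?R" using W by (auto simp: refl_on_def additive_subgroup_def)
    show "sym ?R" by (auto simp: sym_def minus_eq add.commute)
    show "trans ?R"
    proof (rule transI, clarify)
      fix x y z assume "x - y \<in> ?W" "y - z \<in> ?W"
      then have "(x - y) + (y - z) \<in> ?W" using W unfolding additive_subgroup_def by blast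
      then show "x - z \<in> ?W" by simp
    qed
  qed simp
  have class_eq: "?R `` {x} = (\<lambda>w. x + w) ` ?W" for x
    by (auto simp: minus_eq add_self_left intro!: image_eqI[of _ _ "x + y" for y])
  have const: "?Q y = ?Q x" if "y \<in> ?R `` {x}" for x y
    using that assms Q_map_add_E_roots[of "x - y" a b c y] by simp
  have "card (\<Union>?CC) = (\<Sum>C\<in>?CC. card C)"
    by (intro card_Union_disjoint)
      (auto simp: pairwise_def disjnt_def dest: quotient_disj[OF equiv])
  also have "\<dots> = (\<Sum>C\<in>?CC. card ?W)"
  proof (rule sum.cong)
    fix C assume "C \<in> ?CC"
    then obtain x where "C = ?R `` {x}" by (auto elim: quotientE)
    then show "card C = card ?W" unfolding class_eq by (simp add: card_image)
  qed simp
  also have "\<Union>?CC = {x. ?Q x = 0}"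
  proof (intro equalityI subsetI)
    fix x assume "x \<in> {x. ?Q x = 0}"
    then have "\<forall>y\<in>?R `` {x}. ?Q y = 0" using const by auto
    moreover have "?R `` {x} \<in> UNIV // ?R" by (rule quotientI) simp
    ultimately have "?R `` {x} \<in> ?CC" by blast
    moreover have "x \<in> ?R `` {x}" using W by (simp add: additive_subgroup_def)
    ultimately show "x \<in> \<Union>?CC" by blast
  qed auto
  finally show ?thesis by simp
qed

lemma gauss_eq_card: "gauss a b c = 2 * int (card {x. Q_map a b c x = 0}) - 2 ^ d"
proof -
  have "gauss a b c = (\<Sum>x\<in>UNIV. 2 * of_bool (Q_map a b c x = 0) - 1)"
    unfolding gauss_def by (intro sum.cong) (auto simp: chi_def)
  also have "\<dots> = 2 * int (card {x. Q_map a b c x = 0}) - 2 ^ d"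
    by (simp add: sum_subtractf card_field flip: sum_distrib_left)
  finally show ?thesis .
qed

section \<open>Dimensions over the field with two elements\<close>

sublocale vs: vector_space "scale2 :: bit \<Rightarrow> 'a \<Rightarrow> 'a"
  by unfold_locales (auto simp: scale2_def add_self algebra_simps split: if_splits)

lemma additive_subgroup_subspace: "additive_subgroup G \<Longrightarrow> vs.subspace G"
  by (auto simp: vs.subspace_def additive_subgroup_def scale2_def)

text \<open>Every element of \<open>U\<close> is uniquely a 0/1 combination of \<open>B\<close> plus
  an element of \<open>S\<close>.\<close>

lemma card_quotient_basis2:
  fixes U S B :: "'a set"
  assumes S: "additive_subgroup S" and B: "quotient_basis2 U S B"
  shows "card U = card S * 2 ^ card B"
proof -
  define comb :: "('a \<Rightarrow> bit) \<Rightarrow> 'a" where "comb r = (\<Sum>x\<in>B. scale2 (r x) x)" for r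
  define f where "f = (\<lambda>(r, s). comb r + s)"
  \<comment> \<open>Extensional functions make a coefficient family determined by its values on
    \<open>B\<close>, as injectivity demands.\<close>
  let ?D = "(B \<rightarrow>\<^sub>E (UNIV :: bit set)) \<times> S"
  have comb_add: "comb r + comb r' = comb (\<lambda>x. r x + r' x)" for r r'
    unfolding comb_def vs.scale_left_distrib sum.distrib ..
  have indep: "comb r \<in> S \<Longrightarrow> x \<in> B \<Longrightarrow> r x = 0" for r x
    using B by (auto simp: quotient_basis2_def comb_def)
  have inj: "inj_on f ?D"
  proof (rule inj_onI, clarify)
    fix r s r' s'
    assume *: "f (r, s) = f (r', s')" "r \<in> B \<rightarrow>\<^sub>E UNIV" "r' \<in> B \<rightarrow>\<^sub>E UNIV" "s \<in> S" "s' \<in> S"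
    then have "comb r + comb r' = s + s'"
      by (simp add: f_def) (metis add.commute add.left_commute add_self add_0_right)
    then have mem: "comb (\<lambda>x. r x + r' x) \<in> S"
      using S * by (simp add: comb_add additive_subgroup_def)
    have "r x = r' x" if "x \<in> B" for x
    proof -
      have "r x + r' x = 0" using indep[OF mem that] .
      then show ?thesis by (cases "r x"; cases "r' x") auto
    qed
    then have "r = r'" using * by (intro PiE_ext) auto
    then show "r = r' \<and> s = s'" using * by (simp add: f_def)
  qed
  have image: "f ` ?D = vs.span (B \<union> S)"
  proof
    show "f ` ?D \<subseteq> vs.span (B \<union> S)"
      unfolding f_def comb_def
      by (rule image_subsetI, clarsimp)
        (intro vs.span_add vs.span_sum vs.span_scale vs.span_base; blast)
    have f_UNIV: "comb r + s \<in> f ` ?D" if "s \<in> S" for r s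
    proof -
      have "comb (restrict r B) = comb r" by (simp add: comb_def)
      then have "comb r + s = f (restrict r B, s)" by (simp add: f_def)
      then show ?thesis using that by auto
    qed
    have "vs.subspace (f ` ?D)"
    proof (rule additive_subgroup_subspace, unfold additive_subgroup_def, intro conjI ballI)
      have "0 = comb (\<lambda>_. 0) + 0" by (simp add: comb_def)
      then show "0 \<in> f ` ?D" using f_UNIV[of 0 "\<lambda>_. 0"] S
        by (simp add: additive_subgroup_def)
      fix x y assume "x \<in> f ` ?D" "y \<in> f ` ?D"
      then obtain r s r' s' where "x = comb r + s" "y = comb r' + s'" and s: "s \<in> S" "s' \<in> S"
        by (auto simp: f_def)
      then have "x + y = comb (\<lambda>x. r x + r' x) + (s + s')"
        unfolding comb_add[symmetric] by (simp add: algebra_simps)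
      then show "x + y \<in> f ` ?D" using f_UNIV S s by (simp add: additive_subgroup_def)
    qed
    moreover have "B \<union> S \<subseteq> f ` ?D"
    proof
      fix x assume x: "x \<in> B \<union> S"
      show "x \<in> f ` ?D"
      proof (cases "x \<in> S")
        case True
        have "x = comb (\<lambda>_. 0) + x" by (simp add: comb_def)
        then show ?thesis using f_UNIV True by metis
      next
        case False
        have "comb (\<lambda>y. of_bool (y = x)) = (\<Sum>y\<in>B. if y = x then x else 0)"
          unfolding comb_def by (intro sum.cong) (auto simp: scale2_def)
        then have "x = comb (\<lambda>y. of_bool (y = x)) + 0" using x False by simp
        then show ?thesis using f_UNIV S unfolding additive_subgroup_def by metis
      qed
    qed
    ultimately show "vs.span (B \<union> S) \<subseteq> f ` ?D" by (intro vs.span_minimal)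
  qed
  have "card (vs.span (B \<union> S)) = card ?D"
    using card_image[OF inj] unfolding image .
  moreover have "vs.span (B \<union> S) = U" using B by (simp add: quotient_basis2_def)
  moreover have "card (B \<rightarrow>\<^sub>E (UNIV :: bit set)) = 2 ^ card B"
    by (simp add: card_PiE card_bit)
  ultimately show ?thesis by (simp add: card_cartesian_product)
qed

text \<open>A maximal subset of \<open>U\<close> independent modulo \<open>S\<close> spans, since an
  element outside the span could be adjoined.\<close>

lemma ex_quotient_basis2:
  fixes U S :: "'a set"
  assumes U: "additive_subgroup U" and S: "additive_subgroup S" "S \<subseteq> U"
  shows "\<exists>B. quotient_basis2 U S B"
proof -
  define indep where "indep B \<longleftrightarrow> B \<subseteq> U \<and>
      (\<forall>r. (\<Sum>x\<in>B. scale2 (r x) x) \<in> S \<longrightarrow> (\<forall>x\<in>B. r x = (0::bit)))" for B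
  have "indep {}" by (simp add: indep_def)
  then obtain B where B: "indep B" and max: "\<And>B'. indep B' \<Longrightarrow> B \<subseteq> B' \<Longrightarrow> B = B'"
    using finite_has_maximal[of "{B. indep B}"] by (metis empty_iff finite mem_Collect_eq)
  have "U \<subseteq> vs.span (B \<union> S)"
  proof
    fix x assume "x \<in> U"
    show "x \<in> vs.span (B \<union> S)"
    proof (rule ccontr)
      assume x: "x \<notin> vs.span (B \<union> S)"
      then have "x \<notin> B" using vs.span_base by blast
      have "indep (insert x B)"
        unfolding indep_def
      proof (intro conjI allI impI)
        show "insert x B \<subseteq> U" using B \<open>x \<in> U\<close> by (simp add: indep_def)
        fix r :: "'a \<Rightarrow> bit" assume "(\<Sum>y\<in>insert x B. scale2 (r y) y) \<in> S"
        then have mem: "scale2 (r x) x + (\<Sum>y\<in>B. scale2 (r y) y) \<in> S"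
          using \<open>x \<notin> B\<close> by simp
        have "r x = 0"
        proof (rule ccontr)
          assume "r x \<noteq> 0"
          then have "x + (\<Sum>y\<in>B. scale2 (r y) y) \<in> vs.span (B \<union> S)"
            using mem by (auto simp: scale2_def intro: vs.span_base)
          moreover have "(\<Sum>y\<in>B. scale2 (r y) y) \<in> vs.span (B \<union> S)"
            by (intro vs.span_sum vs.span_scale vs.span_base) auto
          ultimately show False using x vs.span_diff by fastforce
        qed
        then show "\<forall>y\<in>insert x B. r y = 0"
          using mem B by (auto simp: indep_def)
      qed
      then show False using max[of "insert x B"] \<open>x \<notin> B\<close> by blast
    qed
  qed
  moreover have "vs.span (B \<union> S) \<subseteq> U"
    using B S U by (intro vs.span_minimal additive_subgroup_subspace) (auto simp: indep_def)
  ultimately have "quotient_basis2 U S B"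
    using B by (auto simp: quotient_basis2_def indep_def)
  then show ?thesis ..
qed

text \<open>A basis exists and the counting formula forces all bases to have equal size, so the
  definite description in \<open>quotient_dim2\<close> denotes.\<close>

lemma card_quotient_dim2:
  fixes U S :: "'a set"
  assumes U: "additive_subgroup U" and S: "additive_subgroup S" "S \<subseteq> U"
  shows "card U = card S * 2 ^ quotient_dim2 U S"
proof -
  obtain B where B: "quotient_basis2 U S B" using ex_quotient_basis2[OF assms] ..
  have "S \<noteq> {}" using S by (auto simp: additive_subgroup_def)
  then have "card B' = card B" if "quotient_basis2 U S B'" for B'
    using card_quotient_basis2[OF S(1) B] card_quotient_basis2[OF S(1) that] by simp
  then have "quotient_dim2 U S = card B"
    unfolding quotient_dim2_def using B by blast
  then show ?thesis using card_quotient_basis2[OF S(1) B] by simp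
qed

lemma card_dim2:
  fixes W :: "'a set"
  assumes W: "additive_subgroup W"
  shows "card W = 2 ^ dim2 W"
proof -
  obtain B where B: "B \<subseteq> W" "vs.independent B" "W \<subseteq> vs.span B" "card B = dim2 W"
    using vs.basis_exists by blast
  have "quotient_basis2 W {0} B"
    unfolding quotient_basis2_def
  proof (intro conjI allI impI ballI)
    fix r :: "'a \<Rightarrow> bit" and x
    assume "(\<Sum>x\<in>B. scale2 (r x) x) \<in> {0}" "x \<in> B"
    then show "r x = 0" using vs.independentD[OF B(2), of B r x] by simp
  next
    have "vs.span B \<subseteq> W" using B W by (intro vs.span_minimal additive_subgroup_subspace)
    then show "vs.span (B \<union> {0}) = W" using B by simp
  qed (use B in auto)
  then have "card W = card {0::'a} * 2 ^ card B"
    by (intro card_quotient_basis2) (auto simp: additive_subgroup_def)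
  then show ?thesis using B by simp
qed

end

section \<open>Factors of \<open>P\<close> and roots of \<open>E\<close>\<close>

text \<open>In \<open>has_factor_type\<close> the factors are fixed only up to units; monic
  representatives make them countable as a set.\<close>

definition monic_irreducible_divisors :: "nat \<Rightarrow> 'a::field poly \<Rightarrow> 'a poly set" where
  "monic_irreducible_divisors d p =
     {g. lead_coeff g = 1 \<and> irreducible g \<and> degree g = d \<and> g dvd p}"

lemma monic_dvd_irreducible:
  fixes f g :: "'a::field poly"
  assumes "irreducible f" "g dvd f" "\<not> is_unit g" "lead_coeff g = 1"
  shows "f = smult (lead_coeff f) g"
proof -
  obtain k where f: "f = g * k" using \<open>g dvd f\<close> by (elim dvdE)
  then have "is_unit k" using assms by (auto simp: irreducible_def)
  then obtain c where "k = [:c:]" by (auto elim: is_unit_polyE)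
  then have "f = smult c g" using f by simp
  then show ?thesis using \<open>lead_coeff g = 1\<close> by simp
qed

text \<open>Without square divisors no two factors are associates, so each step of the induction on
  \<open>F\<close> adds exactly one new monic divisor, in the degree of the added factor.\<close>

lemma card_monic_irreducible_divisors:
  fixes p :: "'a::field poly"
  assumes "\<forall>f\<in>#F. irreducible f" "prod_mset F = p" "\<And>g. g * g dvd p \<Longrightarrow> is_unit g"
  shows "finite (monic_irreducible_divisors d p) \<and>
    card (monic_irreducible_divisors d p) = count (image_mset degree F) d"
  using assms
proof (induction F arbitrary: p)
  case empty
  have "monic_irreducible_divisors d p = {}"
    using empty.prems(2) by (auto simp: monic_irreducible_divisors_def dest: irreducible_not_unit)
  then show ?case by simp
next
  case (add f F)
  define q where "q = prod_mset F"
  \<comment> \<open>The monic associate of \<open>f\<close>: the one monic irreducible divisor of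
    \<open>p\<close> that does not divide \<open>q\<close>.\<close>
  define N where "N = smult (inverse (lead_coeff f)) f"
  have p: "p = f * q" using add.prems(2) by (simp add: q_def)
  have f: "irreducible f" using add.prems(1) by simp
  have f0: "f \<noteq> 0" using f by auto
  have assoc: "g dvd N \<longleftrightarrow> g dvd f" "N dvd g \<longleftrightarrow> f dvd g" for g
    using f0 by (simp_all add: N_def dvd_smult_iff smult_dvd_iff)
  have "is_unit g" if "g * g dvd q" for g
    using that add.prems(3)[of g] by (simp add: p)
  then have IH: "finite (monic_irreducible_divisors d q)"
    "card (monic_irreducible_divisors d q) = count (image_mset degree F) d"
    using add.IH[of q] add.prems(1) q_def by auto
  have "\<not> f dvd q"
  proof
    assume "f dvd q"
    then have "is_unit f" using add.prems(3)[of f] by (simp add: p)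
    then show False using f by (simp add: irreducible_def)
  qed
  then have N_notin: "N \<notin> monic_irreducible_divisors d q"
    by (simp add: monic_irreducible_divisors_def assoc)
  have N_props: "lead_coeff N = 1" "degree N = degree f"
    using f0 by (simp_all add: N_def)
  have N_irred: "irreducible N"
    using f f0 irreducible_mult_unit_left[of "[:inverse (lead_coeff f):]" f]
    by (simp add: N_def is_unit_const_poly_iff dvd_field_iff)
  have eq: "monic_irreducible_divisors d p =
    (if degree f = d then insert N (monic_irreducible_divisors d q)
     else monic_irreducible_divisors d q)"
  proof -
    have eq_N: "g = N" if g: "lead_coeff g = 1" "irreducible g" "g dvd f" for g
    proof -
      have "f = smult (lead_coeff f) g"
        using monic_dvd_irreducible[OF f g(3) _ g(1)] g(2) by (simp add: irreducible_def)
      then have "N = smult (inverse (lead_coeff f)) (smult (lead_coeff f) g)"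
        unfolding N_def by simp
      then show ?thesis using f0 by simp
    qed
    have dvd_cases: "g dvd f \<or> g dvd q" if "irreducible g" "g dvd p" for g
      using that field_poly_irreducible_imp_prime[of g] by (simp add: p prime_elem_dvd_mult_iff)
    have "g \<in> monic_irreducible_divisors d p \<longleftrightarrow>
        g \<in> monic_irreducible_divisors d q \<or> degree f = d \<and> g = N" for g
    proof
      assume g: "g \<in> monic_irreducible_divisors d p"
      show "g \<in> monic_irreducible_divisors d q \<or> degree f = d \<and> g = N"
      proof (cases "g dvd q")
        case False
        then have "g = N"
          using g dvd_cases[of g] eq_N[of g] unfolding monic_irreducible_divisors_def by blast
        then show ?thesis using g N_props by (simp add: monic_irreducible_divisors_def)
      qed (use g in \<open>auto simp: monic_irreducible_divisors_def\<close>)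
    next
      assume "g \<in> monic_irreducible_divisors d q \<or> degree f = d \<and> g = N"
      then show "g \<in> monic_irreducible_divisors d p"
        using N_props N_irred by (auto simp: monic_irreducible_divisors_def p dvd_mult assoc)
    qed
    then show ?thesis by auto
  qed
  show ?case using IH N_notin by (simp add: eq)
qed

lemma degree_1_eq: "degree p = 1 \<Longrightarrow> p = [:coeff p 0, coeff p 1:]"
  by (rule poly_eqI) (auto simp: coeff_pCons coeff_eq_0 split: nat.splits)

lemma card_monic_irreducible_divisors_1:
  "card (monic_irreducible_divisors 1 p) = card {x. poly p x = 0}"
proof -
  have "bij_betw (\<lambda>x. [:- x, 1:]) {x. poly p x = 0} (monic_irreducible_divisors 1 p)"
  proof (rule bij_betwI')
    fix g assume g: "g \<in> monic_irreducible_divisors 1 p"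
    then obtain c where "g = [:c, 1:]"
      using degree_1_eq[of g] by (auto simp: monic_irreducible_divisors_def)
    then have "g = [:- (- c), 1:]" by simp
    moreover have "poly p (- c) = 0"
      using g \<open>g = [:c, 1:]\<close> by (simp add: monic_irreducible_divisors_def poly_eq_0_iff_dvd)
    ultimately show "\<exists>x\<in>{x. poly p x = 0}. g = [:- x, 1:]" by blast
  qed (auto simp: monic_irreducible_divisors_def poly_eq_0_iff_dvd irreducible_linear_field_poly)
  then show ?thesis by (simp add: bij_betw_same_card)
qed

lemma quadratic_reducible_root:
  fixes s t :: "'a::field"
  assumes "\<not> irreducible [:t, s, 1:]"
  obtains x where "poly [:t, s, 1:] x = 0"
proof -
  have "\<not> is_unit [:t, s, 1:]" by (simp add: is_unit_iff_degree)
  then obtain u v where uv: "[:t, s, 1:] = u * v" "\<not> is_unit u" "\<not> is_unit v"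
    using assms by (auto simp: irreducible_def)
  then have "u \<noteq> 0" "v \<noteq> 0" by auto
  then have "degree u + degree v = 2" using degree_mult_eq[of u v] by (simp flip: uv(1))
  then have "degree u = 1"
    using uv \<open>u \<noteq> 0\<close> \<open>v \<noteq> 0\<close> by (simp add: is_unit_iff_degree)
  then obtain c e where u: "u = [:c, e:]" "e \<noteq> 0"
    using degree_1_eq[of u] by (metis leading_coeff_0_iff \<open>u \<noteq> 0\<close>)
  then have "poly u (- c / e) = 0" by simp
  then have "poly [:t, s, 1:] (- c / e) = 0" unfolding uv(1) by simp
  then show ?thesis using that by blast
qed

section \<open>Squarefreeness, quadratic divisors and pairs of roots of \<open>P\<close>\<close>

lemma poly_P_poly: "poly (P_poly a b) x = a\<^sup>2 * x ^ 5 + b\<^sup>2 * x + a"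
  by (simp add: P_poly_def poly_monom)

lemma degree_P_poly: "a \<noteq> 0 \<Longrightarrow> degree (P_poly a b) = 5"
  unfolding P_poly_def
  by (subst degree_add_eq_left; (subst degree_add_eq_left)?)
    (auto simp: degree_monom_eq intro: le_less_trans[OF degree_monom_le])

context binary_field
begin

text \<open>In characteristic 2 the polynomial \<open>P - x P'\<close> is the constant
  \<open>a\<close>, and any \<open>g\<close> whose square divides \<open>P\<close> divides
  it.\<close>

lemma P_poly_squarefree:
  assumes "a \<noteq> (0::'a)" "g * g dvd P_poly a b"
  shows "is_unit g"
proof -
  let ?P = "P_poly a b"
  obtain k where k: "?P = g * g * k" using assms(2) by (elim dvdE)
  have "pderiv ?P = g * (g * pderiv k + k * pderiv g + k * pderiv g)"
    unfolding k by (simp add: pderiv_mult algebra_simps)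
  moreover have "?P = g * (g * k)" using k by (simp add: mult.assoc)
  ultimately have "g dvd ?P - [:0, 1:] * pderiv ?P"
    by (metis dvd_diff dvd_mult dvd_triv_left)
  also have "?P - [:0, 1:] * pderiv ?P = [:a:]"
  proof (rule poly_eqI)
    fix n
    show "coeff (?P - [:0, 1:] * pderiv ?P) n = coeff [:a:] n"
      using numeral_Bit0_eq[of "num.Bit0 num.One"] by (cases n) (auto simp: P_poly_def coeff_pderiv coeff_pCons split: nat.splits)
  qed
  finally show ?thesis using assms(1) dvd_unit_imp_unit[of g "[:a:]"] by (simp add: is_unit_const_poly_iff dvd_field_iff)
qed

text \<open>Division with remainder: the constant term of the remainder determines \<open>t\<close>
  from \<open>s\<close>, and eliminating \<open>t\<close> from the linear term leaves the factor
  \<open>1 + s^5 P(s)\<close> of \<open>E\<close>.\<close>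

lemma quadratic_dvd_P_poly:
  assumes a: "a \<noteq> (0::'a)"
  shows "[:t, s, 1:] dvd P_poly a b \<longleftrightarrow>
    a * s ^ 3 * t = 1 \<and> s ^ 5 * (a\<^sup>2 * s ^ 5 + b\<^sup>2 * s + a) = 1"
proof -
  let ?g = "[:t, s, 1:]"
  define r0 where "r0 = a + a\<^sup>2 * s ^ 3 * t"
  define r1 where "r1 = b\<^sup>2 + a\<^sup>2 * (s ^ 4 + s\<^sup>2 * t + t\<^sup>2)"
  have "P_poly a b = ?g * smult (a\<^sup>2) [:s ^ 3, s\<^sup>2 + t, s, 1:] + [:r0, r1:]"
  proof -
    have "P_poly a b = [:a, b\<^sup>2, 0, 0, 0, a\<^sup>2:]"
      by (simp add: P_poly_def monom_altdef eval_nat_numeral)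
    also have "\<dots> = ?g * smult (a\<^sup>2) [:s ^ 3, s\<^sup>2 + t, s, 1:] + [:r0, r1:]"
      by (simp add: r0_def r1_def algebra_simps add_self_left add_self numeral_Bit0_eq eval_nat_numeral)
    finally show ?thesis .
  qed
  then have "?g dvd P_poly a b \<longleftrightarrow> ?g dvd [:r0, r1:]"
    by (simp only: dvd_add_right_iff[OF dvd_triv_left])
  also have "\<dots> \<longleftrightarrow> [:r0, r1:] = 0"
  proof
    assume "?g dvd [:r0, r1:]"
    show "[:r0, r1:] = 0"
    proof (rule ccontr)
      assume "[:r0, r1:] \<noteq> 0"
      then have "degree ?g \<le> degree [:r0, r1:]" using \<open>?g dvd [:r0, r1:]\<close> by (rule dvd_imp_degree_le[rotated])
      then show False by (simp split: if_splits)
    qed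
  qed simp
  also have "\<dots> \<longleftrightarrow> r0 = 0 \<and> r1 = 0" by simp
  also have "r0 = 0 \<longleftrightarrow> a * s ^ 3 * t = 1"
  proof -
    have "r0 = a * (1 + a * s ^ 3 * t)" by (simp add: r0_def algebra_simps power2_eq_square)
    then show ?thesis using a by (auto simp: add_eq_0_iff)
  qed
  also have "(a * s ^ 3 * t = 1 \<and> r1 = 0) \<longleftrightarrow>
      (a * s ^ 3 * t = 1 \<and> s ^ 5 * (a\<^sup>2 * s ^ 5 + b\<^sup>2 * s + a) = 1)"
  proof (rule conj_cong[OF refl])
    assume t: "a * s ^ 3 * t = 1"
    then have "s \<noteq> 0" by auto
    \<comment> \<open>The factor \<open>s ^ 6\<close> is chosen so that \<open>t\<close> occurs only
      through \<open>a * s ^ 3 * t\<close>, which equals 1.\<close>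
    have "s ^ 6 * r1 = b\<^sup>2 * s ^ 6 + a\<^sup>2 * s ^ 10 + a * s ^ 5 * (a * s ^ 3 * t) + (a * s ^ 3 * t)\<^sup>2"
      by (simp add: r1_def algebra_simps eval_nat_numeral)
    also have "\<dots> = s ^ 5 * (a\<^sup>2 * s ^ 5 + b\<^sup>2 * s + a) + 1"
      unfolding t by (simp add: algebra_simps eval_nat_numeral)
    finally have "s ^ 6 * r1 = s ^ 5 * (a\<^sup>2 * s ^ 5 + b\<^sup>2 * s + a) + 1" .
    then show "r1 = 0 \<longleftrightarrow> s ^ 5 * (a\<^sup>2 * s ^ 5 + b\<^sup>2 * s + a) = 1"
      using \<open>s \<noteq> 0\<close> by (metis add_eq_0_iff mult_eq_0_iff power_eq_0_iff)
  qed
  finally show ?thesis .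
qed

definition P_roots :: "'a \<Rightarrow> 'a \<Rightarrow> 'a set" where
  "P_roots a b = {x. poly (P_poly a b) x = 0}"

text \<open>For \<open>a \<noteq> 0\<close> these are the linear coefficients of the monic quadratic
  divisors of \<open>P\<close> that split over the field.\<close>

definition root_sums :: "'a \<Rightarrow> 'a \<Rightarrow> 'a set" where
  "root_sums a b = {x + y | x y. x \<in> P_roots a b \<and> y \<in> P_roots a b \<and> x \<noteq> y}"

text \<open>The sums of the pairs of roots of \<open>P\<close> in \<open>k\<^sub>2\<close> that are conjugate over \<open>k\<close>.\<close>
definition conj_sums :: "'a \<Rightarrow> 'a \<Rightarrow> 'a set" where
  "conj_sums a b = {s. \<exists>t. irreducible [:t, s, 1:] \<and> [:t, s, 1:] dvd P_poly a b}"

lemma P_roots_iff: "x \<in> P_roots a b \<longleftrightarrow> a\<^sup>2 * x ^ 5 + b\<^sup>2 * x + a = 0"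
  by (simp add: P_roots_def poly_P_poly)

lemma pair_dvd_P_poly:
  assumes "x \<in> P_roots a b" "y \<in> P_roots a b" "x \<noteq> y"
  shows "[:x * y, x + y, 1:] dvd P_poly a b"
proof -
  have "[:x, 1:] dvd P_poly a b"
    using assms(1) by (simp add: P_roots_def poly_eq_0_iff_dvd uminus_eq)
  then obtain r where r: "P_poly a b = [:x, 1:] * r" by (elim dvdE)
  then have "poly r y = 0" using assms(2,3) by (simp add: P_roots_def add_eq_0_iff)
  then have "[:y, 1:] dvd r" by (simp add: poly_eq_0_iff_dvd uminus_eq)
  moreover have "[:x * y, x + y, 1:] = [:x, 1:] * [:y, 1:]" by simp
  ultimately show ?thesis unfolding r by (metis mult_dvd_mono dvd_refl)
qed

context
  fixes a b :: 'a
  assumes a: "a \<noteq> 0"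
begin

text \<open>A reducible monic quadratic with a root \<open>x\<close> has \<open>s + x\<close> as its
  other root. The two differ because \<open>a * s ^ 3 * t = 1\<close> forces
  \<open>s \<noteq> 0\<close>.\<close>

lemma quadratic_divisors_eq:
  "{s. \<exists>t. [:t, s, 1:] dvd P_poly a b} = root_sums a b \<union> conj_sums a b"
proof (intro equalityI subsetI)
  fix s assume "s \<in> {s. \<exists>t. [:t, s, 1:] dvd P_poly a b}"
  then obtain t where t: "[:t, s, 1:] dvd P_poly a b" by blast
  show "s \<in> root_sums a b \<union> conj_sums a b"
  proof (cases "irreducible [:t, s, 1:]")
    case False
    obtain x where x: "poly [:t, s, 1:] x = 0" using quadratic_reducible_root[OF False] .
    then have "x * (s + x) = t" by (simp add: add_eq_0_iff)
    then have "poly [:t, s, 1:] (s + x) = 0"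
      by (simp add: algebra_simps add_self add_self_left)
    moreover have "y \<in> P_roots a b" if "poly [:t, s, 1:] y = 0" for y
      using that t unfolding P_roots_def by (elim dvdE) (simp only: poly_mult mult_zero_left mem_Collect_eq)
    ultimately have "x \<in> P_roots a b" "s + x \<in> P_roots a b" using x by blast+
    moreover have "s \<noteq> 0" using t by (auto simp: quadratic_dvd_P_poly[OF a])
    moreover have "s = x + (s + x)" by (metis add.commute add_self_left)
    moreover have "x \<noteq> s + x" using \<open>s \<noteq> 0\<close> by simp
    ultimately have "s \<in> root_sums a b" unfolding root_sums_def by blast
    then show ?thesis ..
  qed (use t in \<open>auto simp: conj_sums_def\<close>)
next
  fix s assume "s \<in> root_sums a b \<union> conj_sums a b"
  then show "s \<in> {s. \<exists>t. [:t, s, 1:] dvd P_poly a b}"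
    unfolding root_sums_def conj_sums_def using pair_dvd_P_poly by blast
qed

lemma quadratic_divisors_iff:
  "(\<exists>t. [:t, s, 1:] dvd P_poly a b) \<longleftrightarrow> s ^ 5 * (a\<^sup>2 * s ^ 5 + b\<^sup>2 * s + a) = 1"
proof
  assume *: "s ^ 5 * (a\<^sup>2 * s ^ 5 + b\<^sup>2 * s + a) = 1"
  then have "s \<noteq> 0" by auto
  then have "a * s ^ 3 * inverse (a * s ^ 3) = 1" using a by (intro right_inverse) simp
  then show "\<exists>t. [:t, s, 1:] dvd P_poly a b" using * quadratic_dvd_P_poly[OF a] by blast
qed (use quadratic_dvd_P_poly[OF a] in blast)

text \<open>Consequently a pair of distinct roots of \<open>P\<close> is determined by its sum, as
  the sum already fixes the product.\<close>

lemma quadratic_divisor_unique: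
  assumes "[:t, s, 1:] dvd P_poly a b" "[:t', s, 1:] dvd P_poly a b"
  shows "t = t'"
proof -
  have "a * s ^ 3 * t = a * s ^ 3 * t'" "a * s ^ 3 \<noteq> 0"
    using assms by (auto simp: quadratic_dvd_P_poly[OF a])
  then show ?thesis by simp
qed

lemma zero_notin_P_roots: "0 \<notin> P_roots a b"
  using a by (simp add: P_roots_iff)

lemma E_roots_eq:
  "E_roots a b = insert 0 (P_roots a b \<union> (root_sums a b \<union> conj_sums a b))"
proof -
  have "x \<in> E_roots a b \<longleftrightarrow> x = 0 \<or> x \<in> P_roots a b \<or> x ^ 5 * (a\<^sup>2 * x ^ 5 + b\<^sup>2 * x + a) = 1" for x
    unfolding E_roots_iff E_map_factor P_roots_iff mult_eq_0_iff
      add_eq_0_iff[of 1] eq_commute[of 1] by blast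
  then show ?thesis
    unfolding quadratic_divisors_eq[symmetric] quadratic_divisors_iff by blast
qed

lemma quadratic_sums_disjoint:
  "(insert 0 (P_roots a b)) \<inter> (root_sums a b \<union> conj_sums a b) = {}"
  unfolding quadratic_divisors_eq[symmetric] quadratic_divisors_iff
  by (auto simp: P_roots_iff)

text \<open>A common element would give, by uniqueness of \<open>t\<close>, an irreducible quadratic
  with a root in the field.\<close>

lemma root_sums_conj_sums_disjoint: "root_sums a b \<inter> conj_sums a b = {}"
proof -
  have False if s: "s \<in> root_sums a b" "s \<in> conj_sums a b" for s
  proof -
    obtain x y where xy: "x \<in> P_roots a b" "y \<in> P_roots a b" "x \<noteq> y" "s = x + y"
      using s(1) by (auto simp: root_sums_def)
    obtain t where t: "irreducible [:t, s, 1:]" "[:t, s, 1:] dvd P_poly a b"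
      using s(2) by (auto simp: conj_sums_def)
    have "t = x * y" using pair_dvd_P_poly[OF xy(1-3)] t xy(4) quadratic_divisor_unique by blast
    then have "poly [:t, s, 1:] x = 0" by (simp add: xy(4) algebra_simps add_self add_self_left)
    then show False using root_imp_reducible_poly[of "[:t, s, 1:]" x] t(1) by simp
  qed
  then show ?thesis by blast
qed

lemma card_conj_sums: "card (conj_sums a b) = card (monic_irreducible_divisors 2 (P_poly a b))"
proof -
  have "bij_betw (\<lambda>g. coeff g 1) (monic_irreducible_divisors 2 (P_poly a b)) (conj_sums a b)"
  proof -
    have shape: "g = [:coeff g 0, coeff g 1, 1:]"
      if "g \<in> monic_irreducible_divisors 2 (P_poly a b)" for g
    proof (rule poly_eqI)
      fix n
      have "coeff g 2 = 1" "degree g = 2" using that by (auto simp: monic_irreducible_divisors_def)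
      then show "coeff g n = coeff [:coeff g 0, coeff g 1, 1:] n"
        by (auto simp: coeff_pCons coeff_eq_0 eval_nat_numeral split: nat.splits)
    qed
    show ?thesis
    proof (rule bij_betwI')
      fix g g' assume g: "g \<in> monic_irreducible_divisors 2 (P_poly a b)"
        "g' \<in> monic_irreducible_divisors 2 (P_poly a b)"
      then have "[:coeff g 0, coeff g 1, 1:] dvd P_poly a b" "[:coeff g' 0, coeff g' 1, 1:] dvd P_poly a b"
        using shape by (auto simp: monic_irreducible_divisors_def)
      then show "coeff g 1 = coeff g' 1 \<longleftrightarrow> g = g'"
        using quadratic_divisor_unique shape g by metis
    next
      fix g assume g: "g \<in> monic_irreducible_divisors 2 (P_poly a b)"
      then have "irreducible [:coeff g 0, coeff g 1, 1:]" "[:coeff g 0, coeff g 1, 1:] dvd P_poly a b"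
        unfolding shape[OF g, symmetric] using g by (simp_all add: monic_irreducible_divisors_def)
      then show "coeff g 1 \<in> conj_sums a b" unfolding conj_sums_def by blast
    next
      fix s assume "s \<in> conj_sums a b"
      then obtain t where "irreducible [:t, s, 1:]" "[:t, s, 1:] dvd P_poly a b"
        by (auto simp: conj_sums_def)
      then show "\<exists>g\<in>monic_irreducible_divisors 2 (P_poly a b). s = coeff g 1"
        by (intro bexI[of _ "[:t, s, 1:]"]) (auto simp: monic_irreducible_divisors_def)
    qed
  qed
  then show ?thesis by (simp add: bij_betw_same_card)
qed

lemma has_factor_type_counts:
  assumes "has_factor_type (P_poly a b) ns"
  shows "card (P_roots a b) = count ns 1" "card (conj_sums a b) = count ns 2"
proof -
  obtain F where F: "\<forall>f\<in>#F. irreducible f" "prod_mset F = P_poly a b" "image_mset degree F = ns"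
    using assms by (auto simp: has_factor_type_def)
  have "card (monic_irreducible_divisors d (P_poly a b)) = count ns d" for d
    using card_monic_irreducible_divisors[OF F(1,2) P_poly_squarefree[OF a], where d = d] F(3) by simp
  then show "card (P_roots a b) = count ns 1" "card (conj_sums a b) = count ns 2"
    unfolding card_conj_sums P_roots_def card_monic_irreducible_divisors_1[symmetric] by simp_all
qed

text \<open>Each element of \<open>root_sums\<close> comes from exactly two ordered pairs, since the
  sum fixes the product and both together fix the pair up to order.\<close>

lemma sum_root_sums:
  fixes f :: "'a \<Rightarrow> int"
  shows "(\<Sum>x\<in>P_roots a b. \<Sum>y\<in>P_roots a b - {x}. f (x + y)) = 2 * (\<Sum>s\<in>root_sums a b. f s)"
proof -
  let ?Z = "P_roots a b"
  let ?D = "SIGMA x:?Z. ?Z - {x}"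
  have "(\<Sum>x\<in>?Z. \<Sum>y\<in>?Z - {x}. f (x + y)) = (\<Sum>p\<in>?D. f (fst p + snd p))"
    by (subst sum.Sigma) (auto simp: case_prod_unfold)
  also have "\<dots> = (\<Sum>s\<in>(\<lambda>p. fst p + snd p) ` ?D.
      \<Sum>p\<in>{p \<in> ?D. fst p + snd p = s}. f (fst p + snd p))"
    by (rule sum.image_gen) simp
  also have "(\<lambda>p. fst p + snd p) ` ?D = root_sums a b"
    by (force simp: root_sums_def)
  also have "(\<Sum>s\<in>root_sums a b. \<Sum>p\<in>{p \<in> ?D. fst p + snd p = s}. f (fst p + snd p)) =
      (\<Sum>s\<in>root_sums a b. 2 * f s)"
  proof (rule sum.cong[OF refl])
    fix s assume "s \<in> root_sums a b"
    then obtain x y where xy: "x \<in> ?Z" "y \<in> ?Z" "x \<noteq> y" "s = x + y"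
      by (auto simp: root_sums_def)
    have "{p \<in> ?D. fst p + snd p = s} = {(x, y), (y, x)}"
    proof (intro equalityI subsetI)
      fix p assume p: "p \<in> {p \<in> ?D. fst p + snd p = s}"
      obtain x' y' where p_eq: "p = (x', y')" by (cases p)
      then have p': "x' \<in> ?Z" "y' \<in> ?Z" "x' \<noteq> y'" "x' + y' = x + y"
        using p xy by auto
      then have "x' * y' = x * y"
        using pair_dvd_P_poly[OF xy(1-3)] pair_dvd_P_poly[OF p'(1-3)] quadratic_divisor_unique
        by metis
      moreover have y': "y' = x' + (x + y)" using p'(4) by (metis add_self_left)
      \<comment> \<open>This evaluates the quadratic with roots \<open>x\<close> and
        \<open>y\<close> at \<open>x'\<close>; with equal products it vanishes.\<close>
      moreover have "(x' + x) * (x' + y) = x' * y' + x * y"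
        unfolding y' by (simp add: algebra_simps)
      ultimately have "(x' + x) * (x' + y) = 0" by (simp only: add_self)
      then have "x' = x \<or> x' = y" by (simp add: add_eq_0_iff)
      then show "p \<in> {(x, y), (y, x)}"
        using y' add_self_left[of x y] add_self_left[of y x] by (auto simp: p_eq add.commute)
    qed (use xy in \<open>auto simp: add.commute\<close>)
    then have "(\<Sum>p\<in>{p \<in> ?D. fst p + snd p = s}. f (fst p + snd p)) =
        (\<Sum>p\<in>{(x, y), (y, x)}. f (fst p + snd p))" by simp
    then show "(\<Sum>p\<in>{p \<in> ?D. fst p + snd p = s}. f (fst p + snd p)) = 2 * f s"
      using xy by (simp add: add.commute)
  qed
  finally show ?thesis by (simp add: sum_distrib_left)
qed

text \<open>The second elementary symmetric function expressed by power sums, for values of square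
  1. The constant \<open>f\<close> counts the sums, and the character of the form evaluates their
  contribution.\<close>

lemma sum_root_sums_multiplicative:
  fixes f :: "'a \<Rightarrow> int"
  assumes "\<And>x y. x \<in> P_roots a b \<Longrightarrow> y \<in> P_roots a b \<Longrightarrow> f (x + y) = f x * f y"
    and "\<And>x. f x * f x = 1"
  shows "2 * (\<Sum>s\<in>root_sums a b. f s) = (\<Sum>x\<in>P_roots a b. f x)\<^sup>2 - int (card (P_roots a b))"
proof -
  have "2 * (\<Sum>s\<in>root_sums a b. f s) = (\<Sum>x\<in>P_roots a b. \<Sum>y\<in>P_roots a b - {x}. f x * f y)"
    unfolding sum_root_sums[symmetric] using assms(1) by (intro sum.cong) auto
  also have "\<dots> = (\<Sum>x\<in>P_roots a b. f x * (\<Sum>y\<in>P_roots a b. f y) - 1)"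
  proof (rule sum.cong[OF refl])
    fix x assume "x \<in> P_roots a b"
    then have "(\<Sum>y\<in>P_roots a b. f x * f y) = f x * f x + (\<Sum>y\<in>P_roots a b - {x}. f x * f y)"
      by (intro sum.remove) auto
    then show "(\<Sum>y\<in>P_roots a b - {x}. f x * f y) = f x * (\<Sum>y\<in>P_roots a b. f y) - 1"
      by (simp add: assms(2) sum_distrib_left)
  qed
  also have "\<dots> = (\<Sum>x\<in>P_roots a b. f x)\<^sup>2 - int (card (P_roots a b))"
    by (simp add: sum_subtractf power2_eq_square flip: sum_distrib_right)
  finally show ?thesis .
qed

lemma card_E_roots:
  "2 * card (E_roots a b) =
     2 + card (P_roots a b) * (card (P_roots a b) + 1) + 2 * card (conj_sums a b)"
proof -
  let ?Z = "P_roots a b"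
  have "2 * int (card (root_sums a b)) = (int (card ?Z))\<^sup>2 - int (card ?Z)"
    using sum_root_sums_multiplicative[of "\<lambda>_. 1"] by simp
  moreover have "card (E_roots a b) = 1 + card ?Z + (card (root_sums a b) + card (conj_sums a b))"
    unfolding E_roots_eq
    using zero_notin_P_roots quadratic_sums_disjoint root_sums_conj_sums_disjoint
    by (subst card_insert_disjoint card_Un_disjoint; auto)+
  ultimately have "int (2 * card (E_roots a b)) =
      int (2 + card ?Z * (card ?Z + 1) + 2 * card (conj_sums a b))"
    by (simp add: power2_eq_square algebra_simps)
  then show ?thesis by (simp only: of_nat_eq_iff)
qed

text \<open>The equation of \<open>z\<close> is used twice. Multiplied by \<open>z ^ 5\<close> it
  makes \<open>(b z^3)^2\<close> the sum of \<open>a z^5\<close> and its square, so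
  \<open>b z^3\<close> has trace 0; divided by \<open>a\<close> it rewrites \<open>a z^5\<close> as
  a linear term plus 1.\<close>

lemma Q_map_P_roots:
  assumes "z \<in> P_roots a b"
  shows "Q_map a b c z = ell d a b c z + tr 1"
proof -
  have z: "a\<^sup>2 * z ^ 5 + b\<^sup>2 * z + a = 0" using assms by (simp add: P_roots_iff)
  have bz: "b\<^sup>2 * z = a\<^sup>2 * z ^ 5 + a"
    using z add_eq_0_iff[of "b\<^sup>2 * z" "a\<^sup>2 * z ^ 5 + a"] by (simp add: ac_simps)
  then have "z ^ 5 * (b\<^sup>2 * z) = z ^ 5 * (a\<^sup>2 * z ^ 5 + a)" by simp
  then have "(b * z ^ 3)\<^sup>2 = (a * z ^ 5)\<^sup>2 + a * z ^ 5"
    by (simp add: power_mult_distrib algebra_simps eval_nat_numeral)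
  then have "tr ((b * z ^ 3)\<^sup>2) = tr ((a * z ^ 5)\<^sup>2) + tr (a * z ^ 5)"
    by (simp only: tr_add)
  then have 1: "tr (b * z ^ 3) = 0" by (simp only: tr_square add_self)
  have "a * (a * z ^ 5) = b\<^sup>2 * z + a"
    using z add_eq_0_iff[of "a\<^sup>2 * z ^ 5" "b\<^sup>2 * z + a"] by (simp add: ac_simps power2_eq_square)
  then have 2: "a * z ^ 5 = b\<^sup>2 * inverse a * z + 1"
    using a by (simp add: field_simps)
  have "Q_map a b c z = tr (a * z ^ 5) + tr (c * z)"
    by (simp add: Q_map_def tr_add 1)
  also have "\<dots> = tr ((c + b\<^sup>2 * inverse a) * z + 1)"
    unfolding 2 tr_add[symmetric] by (simp add: algebra_simps)
  finally show ?thesis by (simp add: ell_def tr_add)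
qed

end

end

section \<open>The quadratic extension\<close>

locale quadratic_extension =
  fixes h :: "'k::{field,finite} \<Rightarrow> 'l::{field,finite}" and m :: nat
  assumes card_k: "CARD('k) = 2 ^ m" and card_l: "CARD('l) = 2 ^ (2 * m)"
    and embedding: "field_embedding h"
begin

sublocale k: binary_field "TYPE('k)" m by unfold_locales (rule card_k)
sublocale l: binary_field "TYPE('l)" "2 * m" by unfold_locales (rule card_l)

lemma h_1 [simp]: "h 1 = 1"
  and h_add: "h (x + y) = h x + h y"
  and h_mult: "h (x * y) = h x * h y"
  using embedding by (auto simp: field_embedding_def)

lemma h_0 [simp]: "h 0 = 0"
  using h_add[of 0 0] by (metis add_0 add_cancel_right_right)

lemma h_power: "h (x ^ n) = h x ^ n"
  by (induction n) (simp_all add: h_mult)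

lemma h_sum: "h (\<Sum>i\<in>A. f i) = (\<Sum>i\<in>A. h (f i))"
  by (induction A rule: infinite_finite_induct) (simp_all add: h_add)

lemma h_eq_0_iff [simp]: "h x = 0 \<longleftrightarrow> x = 0"
proof
  assume "h x = 0"
  then have "h (x * inverse x) = 0" by (simp add: h_mult)
  then show "x = 0" using right_inverse by force
qed simp

lemma h_eq_iff [simp]: "h x = h y \<longleftrightarrow> x = y"
  by (metis h_add h_eq_0_iff k.add_eq_0_iff l.add_eq_0_iff)

lemma h_tr: "h (k.tr x) = abs_trace m (h x)"
  by (simp add: abs_trace_def h_sum h_power)

lemma h_frobenius: "h x ^ 2 ^ m = h x"
  by (metis h_power k.fermat)

lemma frobenius_frobenius: "(x ^ 2 ^ m) ^ 2 ^ m = (x :: 'l)"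
  using l.fermat[of x] by (simp add: mult_2 power_add flip: power_mult)

text \<open>The image of \<open>h\<close> consists of roots of \<open>x^q - x\<close> with
  \<open>q = 2 ^ m\<close>, and it already has \<open>q\<close> elements, the maximal number of
  roots.\<close>

lemma range_h: "x \<in> range h \<longleftrightarrow> x ^ 2 ^ m = x"
proof -
  let ?p = "monom 1 (2 ^ m) - monom 1 1 :: 'l poly"
  have "(2::nat) ^ m \<noteq> 1" using k.dim_pos by simp
  then have "coeff ?p 1 \<noteq> 0" by simp
  then have "?p \<noteq> 0" by (metis coeff_0)
  moreover have "degree ?p \<le> 2 ^ m"
    by (intro degree_diff_le) (auto simp: degree_monom_eq)
  ultimately have "card {x. poly ?p x = 0} \<le> 2 ^ m"
    using card_poly_roots_bound[of ?p] by simp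
  moreover have "{x. poly ?p x = 0} = {x. x ^ 2 ^ m = x}" by (simp add: poly_monom)
  moreover have "range h \<subseteq> {x. x ^ 2 ^ m = x}" by (auto simp: h_frobenius)
  moreover have "card (range h) = 2 ^ m" by (simp add: card_image inj_on_def card_k)
  ultimately have "range h = {x. x ^ 2 ^ m = x}" by (intro card_seteq) auto
  then show ?thesis by blast
qed

section \<open>The relative trace and the decomposition of the extension as
  \<open>k + k u0\<close>\<close>

definition trace :: "'l \<Rightarrow> 'k" where
  "trace x = inv h (x + x ^ 2 ^ m)"

text \<open>The argument of \<open>inv h\<close> is fixed by conjugation, hence in the range of
  \<open>h\<close>, so the inverse is a genuine preimage.\<close>

lemma h_trace: "h (trace x) = x + x ^ 2 ^ m"
  unfolding trace_def by (intro f_inv_into_f)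
    (simp add: range_h l.frobenius_add frobenius_frobenius add.commute)

lemma trace_add: "trace (x + y) = trace x + trace y"
proof -
  have "h (trace (x + y)) = h (trace x + trace y)"
    unfolding h_add h_trace l.frobenius_add by (simp only: add_ac)
  then show ?thesis by simp
qed

lemma trace_h [simp]: "trace (h x) = 0"
  using h_trace[of "h x"] by (simp only: h_frobenius l.add_self h_eq_0_iff)

lemma trace_0 [simp]: "trace 0 = 0"
  using trace_h[of 0] by simp

lemma trace_h_mult: "trace (h x * y) = x * trace y"
proof -
  have "h (trace (h x * y)) = h (x * trace y)"
    unfolding h_mult h_trace power_mult_distrib h_frobenius by (simp add: algebra_simps)
  then show ?thesis by simp
qed

lemma trace_eq_0_iff: "trace x = 0 \<longleftrightarrow> x \<in> range h"
proof -
  have "trace x = 0 \<longleftrightarrow> h (trace x) = 0" by simp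
  also have "\<dots> \<longleftrightarrow> x \<in> range h"
    unfolding h_trace l.add_eq_0_iff range_h by auto
  finally show ?thesis .
qed

text \<open>Transitivity of the trace: the upper half of the \<open>2 * m\<close> conjugates of
  \<open>x\<close> consists of the lower half formed for the conjugate of \<open>x\<close> over
  \<open>k\<close>.\<close>

lemma tr_eq: "l.tr x = h (k.tr (trace x))"
proof -
  have "(\<Sum>i<2 * m. x ^ 2 ^ i) = (\<Sum>i<m. x ^ 2 ^ i) + (\<Sum>i=m..<m + m. x ^ 2 ^ i)"
    by (simp add: mult_2 lessThan_atLeast0 sum.atLeastLessThan_concat)
  also have "(\<Sum>i=m..<m + m. x ^ 2 ^ i) = (\<Sum>i<m. (x ^ 2 ^ m) ^ 2 ^ i)"
    using sum.shift_bounds_nat_ivl[of "\<lambda>i. x ^ 2 ^ i" 0 m m]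
    by (simp add: lessThan_atLeast0 power_add mult.commute[of "2 ^ i" "2 ^ m" for i] power_mult)
  finally show ?thesis
    unfolding h_tr h_trace by (simp add: abs_trace_def l.frobenius_add sum.distrib)
qed

lemma ex_trace_1: "\<exists>u. trace u = 1"
proof -
  have "card (range h) \<noteq> CARD('l)"
    using k.dim_pos by (simp add: card_image inj_on_def card_k card_l)
  then have "range h \<noteq> UNIV" by metis
  then obtain x where x: "x \<notin> range h" by blast
  then have "trace x \<noteq> 0" by (simp add: trace_eq_0_iff)
  then have "trace (h (inverse (trace x)) * x) = 1" by (simp add: trace_h_mult)
  then show ?thesis ..
qed

definition u0 :: 'l where "u0 = (SOME u. trace u = 1)"

lemma trace_u0 [simp]: "trace u0 = 1"
  unfolding u0_def by (rule someI_ex[OF ex_trace_1])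

lemma u0_frobenius: "u0 ^ 2 ^ m = u0 + 1"
  using h_trace[of u0] by (metis h_1 l.add_self_left trace_u0)

text \<open>The norm \<open>u0 * (u0 + 1)\<close> of \<open>u0\<close>, so that \<open>u0\<close> is
  a root of \<open>X^2 + X + t0\<close>.\<close>

definition t0 :: 'k where "t0 = inv h (u0\<^sup>2 + u0)"

lemma h_t0: "h t0 = u0\<^sup>2 + u0"
proof -
  have "(u0\<^sup>2) ^ 2 ^ m = (u0 ^ 2 ^ m)\<^sup>2" by (simp add: mult.commute flip: power_mult)
  then have "(u0\<^sup>2 + u0) ^ 2 ^ m = (u0 + 1)\<^sup>2 + (u0 + 1)"
    by (simp add: l.frobenius_add u0_frobenius)
  also have "\<dots> = u0\<^sup>2 + u0"
    by (simp add: l.square_add l.two_eq_0)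
  finally have "u0\<^sup>2 + u0 \<in> range h" by (simp add: range_h)
  then show ?thesis unfolding t0_def by (rule f_inv_into_f)
qed

text \<open>The conjugates of \<open>u0^2 + u0\<close> telescope to \<open>u0 ^ 2 ^ m + u0\<close>,
  which is 1. This value produces the sign in \<open>eta\<close>.\<close>

lemma tr_t0: "k.tr t0 = 1"
proof -
  have "abs_trace n (u0\<^sup>2 + u0) = u0 ^ 2 ^ n + u0" for n
  proof (induction n)
    case (Suc n)
    have "abs_trace (Suc n) (u0\<^sup>2 + u0) = abs_trace n (u0\<^sup>2 + u0) + (u0\<^sup>2 + u0) ^ 2 ^ n"
      by (simp add: abs_trace_def)
    also have "\<dots> = (u0 ^ 2 ^ n + u0) + (u0 ^ 2 ^ Suc n + u0 ^ 2 ^ n)"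
      by (simp add: Suc l.frobenius_add flip: power_mult)
    finally show ?case by (simp add: l.add_self_left algebra_simps)
  qed (simp add: abs_trace_def l.add_self)
  from this[of m] have "h (k.tr t0) = u0 + (u0 + 1)"
    by (simp add: h_tr h_t0 u0_frobenius add.commute)
  then have "h (k.tr t0) = h 1" by (simp only: l.add_self_left h_1)
  then show ?thesis by (simp only: h_eq_iff)
qed

text \<open>The trace kills \<open>k\<close> and sends \<open>u0\<close> to 1, so it reads off the
  coordinate \<open>y\<close>.\<close>

lemma bij_decomposition: "bij (\<lambda>(x, y). h x + h y * u0)"
proof (rule bijI)
  show "inj (\<lambda>(x, y). h x + h y * u0)"
  proof (rule injI, clarify)
    fix x y x' y' assume *: "h x + h y * u0 = h x' + h y' * u0"
    then have "trace (h x + h y * u0) = trace (h x' + h y' * u0)" by simp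
    then have "y = y'" by (simp add: trace_add trace_h_mult)
    then show "x = x' \<and> y = y'" using * by simp
  qed
  have "z \<in> range (\<lambda>(x, y). h x + h y * u0)" for z
  proof -
    have "trace (z + h (trace z) * u0) = 0"
      by (simp add: trace_add trace_h_mult k.add_self)
    then obtain x where "z + h (trace z) * u0 = h x" by (auto simp: trace_eq_0_iff)
    then have "z = h x + h (trace z) * u0"
      by (metis add.commute l.add_self_left)
    then show ?thesis by (intro image_eqI[of _ _ "(x, trace z)"]) auto
  qed
  then show "surj (\<lambda>(x, y). h x + h y * u0)" by auto
qed

lemma trace_surj: "surj trace"
proof (rule surjI)
  show "trace (h y * u0) = y" for y by (simp add: trace_h_mult)
qed

section \<open>The radical over the extension and the dimension of \<open>U\<close> modulo
  \<open>k\<close> plus the radical\<close>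

lemma h_E_map: "h (k.E_map a b x) = l.E_map (h a) (h b) (h x)"
  by (simp add: k.E_map_def l.E_map_def h_add h_mult h_power)

lemma trace_E_map: "trace (l.E_map (h a) (h b) z) = k.E_map a b (trace z)"
proof -
  have pow: "(w ^ n) ^ 2 ^ m = (w ^ 2 ^ m) ^ n" for w :: 'l and n
    by (simp add: mult.commute flip: power_mult)
  have "(l.E_map (h a) (h b) z) ^ 2 ^ m = l.E_map (h a) (h b) (z ^ 2 ^ m)"
    by (simp add: l.E_map_def l.frobenius_add power_mult_distrib h_frobenius pow)
  then have "h (trace (l.E_map (h a) (h b) z)) = h (k.E_map a b (trace z))"
    by (simp add: h_trace h_E_map l.E_map_add)
  then show ?thesis by simp
qed

lemma h_mem_E_roots: "h x \<in> E_roots (h a) (h b) \<longleftrightarrow> x \<in> E_roots a b"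
  by (simp add: l.E_roots_iff k.E_roots_iff flip: h_E_map)

text \<open>The fibres of \<open>trace\<close> on \<open>G\<close> are cosets of the part of
  \<open>G\<close> lying in \<open>k\<close>.\<close>

lemma card_additive_subgroup_trace:
  assumes G: "additive_subgroup (G :: 'l set)"
  shows "card G = card (trace ` G) * card {x. h x \<in> G}"
proof -
  have "card {g \<in> G. trace g = y} = card {x. h x \<in> G}" if "y \<in> trace ` G" for y
  proof -
    obtain g where g: "g \<in> G" "y = trace g" using \<open>y \<in> trace ` G\<close> by auto
    have "bij_betw (\<lambda>x. h x + g) {x. h x \<in> G} {g \<in> G. trace g = y}"
    proof (rule bij_betwI')
      fix z assume z: "z \<in> {g \<in> G. trace g = y}"
      then have "trace (z + g) = 0" using g by (simp add: trace_add k.add_self)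
      then obtain x where x: "h x = z + g" by (auto simp: trace_eq_0_iff)
      then have "h x \<in> G" "z = h x + g"
        using z g G by (auto simp: additive_subgroup_def add.assoc l.add_self)
      then show "\<exists>x\<in>{x. h x \<in> G}. z = h x + g" by blast
    qed (use g G in \<open>auto simp: additive_subgroup_def trace_add\<close>)
    then show ?thesis by (simp add: bij_betw_same_card)
  qed
  then have "(\<Sum>y\<in>trace ` G. card {g \<in> G. trace g = y}) =
      card (trace ` G) * card {x. h x \<in> G}" by simp
  moreover have "(\<Sum>y\<in>trace ` G. card {g \<in> G. trace g = y}) = card G"
    using card_eq_sum sum.image_gen[of G "\<lambda>_. 1::nat" trace] by simp
  ultimately show ?thesis by simp
qed

text \<open>The two terms with \<open>(h c)\<^sup>2\<close> cancel, leaving the polar form of the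
  quadratic form, which \<open>tr_E_map\<close> and transitivity of the trace carry down to
  \<open>k\<close>.\<close>

lemma R_form_h:
  "R_form m (h a) (h b) (h c) u (h y) = h (k.tr (y ^ 4 * k.E_map a b (trace u)))"
proof -
  have "u * R_map (h a) (h b) (h c) (h y) + h y * R_map (h a) (h b) (h c) u =
      (h a * (u ^ 4 * h y + u * h y ^ 4) + h b * (u\<^sup>2 * h y + u * (h y)\<^sup>2)) +
      (u * (h c)\<^sup>2 * h y + u * (h c)\<^sup>2 * h y)"
    by (simp only: R_map_def algebra_simps)
  then have "R_form m (h a) (h b) (h c) u (h y) =
      l.tr (h a * (u ^ 4 * h y + u * h y ^ 4) + h b * (u\<^sup>2 * h y + u * (h y)\<^sup>2))"
    by (simp only: R_form_def l.add_self add_0_right)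
  also have "\<dots> = l.tr (h y ^ 4 * l.E_map (h a) (h b) u)" by (rule l.tr_E_map[symmetric])
  also have "\<dots> = h (k.tr (y ^ 4 * k.E_map a b (trace u)))"
    by (simp add: tr_eq trace_h_mult trace_E_map flip: h_power)
  finally show ?thesis .
qed

lemma U_space_eq: "U_space h m a b c = {u. trace u \<in> E_roots a b}"
proof -
  have "(\<forall>y. k.tr (y ^ 4 * e) = 0) \<longleftrightarrow> e = 0" for e
  proof
    assume "\<forall>y. k.tr (y ^ 4 * e) = 0"
    \<comment> \<open>All summands are 1, so the sum is nonzero, which orthogonality permits only
      for \<open>e = 0\<close>.\<close>
    then have "(\<Sum>y\<in>UNIV. chi (k.tr (y ^ 4 * e))) = 2 ^ m" using card_k by simp
    then show "e = 0" using k.sum_chi_tr_power4[of e] by (auto split: if_splits)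
  qed simp
  then show ?thesis by (simp add: U_space_def R_form_h k.E_roots_iff)
qed

text \<open>With \<open>T\<close> the image of the radical \<open>?W'\<close> under
  \<open>trace\<close>, the orders of \<open>?U\<close>, \<open>?S\<close> and \<open>?W'\<close>
  are \<open>q |W|\<close>, \<open>q |T|\<close> and \<open>|T| |W|\<close>. Hence the index of
  \<open>?S\<close> in \<open>?U\<close>, times the order of \<open>?W'\<close>, is
  \<open>|W|^2\<close>.\<close>

lemma quotient_dim2_U_space:
  "quotient_dim2 (U_space h m a b c) {h x + v | x v. v \<in> E_roots (h a) (h b)} +
     dim2 (E_roots (h a) (h b)) = 2 * dim2 (E_roots a b)"
proof -
  let ?U = "U_space h m a b c" and ?W = "E_roots a b" and ?W' = "E_roots (h a) (h b)"
  let ?S = "{h x + v | x v. v \<in> ?W'}"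
  have W': "additive_subgroup ?W'" by (rule l.additive_subgroup_E_roots)
  have U: "additive_subgroup ?U"
    using k.additive_subgroup_E_roots[of a b]
    by (simp add: additive_subgroup_def U_space_eq trace_add)
  have S: "additive_subgroup ?S"
    unfolding additive_subgroup_def
  proof (intro conjI ballI)
    show "0 \<in> ?S" using W' by (auto simp: additive_subgroup_def intro!: exI[of _ 0])
    fix x y assume "x \<in> ?S" "y \<in> ?S"
    then obtain x' v y' w where "x = h x' + v" "y = h y' + w" "v \<in> ?W'" "w \<in> ?W'" by auto
    then have "x + y = h (x' + y') + (v + w)" "v + w \<in> ?W'"
      using W' by (auto simp: h_add additive_subgroup_def algebra_simps)
    then show "x + y \<in> ?S" by blast
  qed
  have tr_W': "trace v \<in> ?W" if "v \<in> ?W'" for v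
    using that trace_E_map[of a b v] by (simp add: k.E_roots_iff l.E_roots_iff)
  have SU: "?S \<subseteq> ?U" using tr_W' by (auto simp: U_space_eq trace_add)
  have 0: "0 \<in> ?W'" using W' by (simp add: additive_subgroup_def)
  have "card ?W' = card (trace ` ?W') * card ?W"
    using card_additive_subgroup_trace[OF W'] by (simp add: h_mem_E_roots)
  moreover have "card ?S = card (trace ` ?W') * 2 ^ m"
  proof -
    have "trace ` ?S = trace ` ?W'"
    proof
      show "trace ` ?S \<subseteq> trace ` ?W'" by (auto simp: trace_add)
      have "v \<in> ?S" if "v \<in> ?W'" for v
      proof -
        have "v = h 0 + v" by simp
        then show ?thesis using that by blast
      qed
      then show "trace ` ?W' \<subseteq> trace ` ?S" by blast
    qed
    moreover have "h x \<in> ?S" for x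
    proof -
      have "h x = h x + 0" by simp
      then show ?thesis using 0 by blast
    qed
    then have "{x. h x \<in> ?S} = UNIV" by blast
    ultimately show ?thesis
      using card_additive_subgroup_trace[OF S] card_k by simp
  qed
  moreover have "card ?U = card ?W * 2 ^ m"
  proof -
    have "trace ` ?U = ?W" using trace_surj by (auto simp: U_space_eq surj_def image_iff)
    moreover have "{x. h x \<in> ?U} = UNIV"
      using k.additive_subgroup_E_roots[of a b] by (simp add: U_space_eq additive_subgroup_def)
    ultimately show ?thesis
      using card_additive_subgroup_trace[OF U] card_k by simp
  qed
  moreover have "card ?U = card ?S * 2 ^ quotient_dim2 ?U ?S"
    by (rule l.card_quotient_dim2[OF U S SU])
  ultimately have "card ?W * card ?W = card ?W' * 2 ^ quotient_dim2 ?U ?S" by simp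
  then have "(2::nat) ^ (2 * dim2 ?W) = 2 ^ (quotient_dim2 ?U ?S + dim2 ?W')"
    unfolding k.card_dim2[OF k.additive_subgroup_E_roots] l.card_dim2[OF W']
    by (simp add: power_add mult_2 mult.commute)
  then show ?thesis by simp
qed

text \<open>For \<open>y \<in> W\<close> this is \<open>(-1)\<close> to the power \<open>y\<^sup>5 P(y)\<close>, which is \<open>0\<close> or \<open>1\<close>.\<close>
definition eta :: "'a::field \<Rightarrow> 'a \<Rightarrow> 'a \<Rightarrow> int" where
  "eta a b y = (if y = 0 \<or> a\<^sup>2 * y ^ 5 + b\<^sup>2 * y + a = 0 then 1 else -1)"

definition weight_sum :: "'k \<Rightarrow> 'k \<Rightarrow> 'k \<Rightarrow> int" where
  "weight_sum a b c = (\<Sum>y\<in>E_roots a b. eta a b y * chi (k.Q_map a b c y))"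

section \<open>Reduction of the exponential sum over the extension to a signed sum over
  \<open>W\<close>\<close>

lemma chi_h: "chi (h x) = chi x"
  by (simp add: chi_def)

lemma Q_map_h [simp]: "l.Q_map (h a) (h b) (h c) (h x) = 0"
  by (simp add: l.Q_map_def tr_eq flip: h_mult h_power h_add)

lemma trace_u0_powers:
  "trace (u0 ^ 3) = t0 + 1" "trace (u0 ^ 5) = t0\<^sup>2 + t0 + 1"
proof -
  have conj: "(u0 ^ n) ^ 2 ^ m = (u0 + 1) ^ n" for n
    by (metis u0_frobenius mult.commute power_mult)
  have "h (trace (u0 ^ 3)) = h (t0 + 1)"
    unfolding h_trace conj l.power_add_expand h_add h_t0
    by (simp add: l.add_self_left l.two_eq_0 algebra_simps)
  then show "trace (u0 ^ 3) = t0 + 1" by simp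
  have "h (trace (u0 ^ 5)) = u0 ^ 4 + u0 + 1"
    unfolding h_trace conj l.power_add_expand
    by (simp add: l.add_self_left l.two_eq_0 algebra_simps)
  moreover have "h (t0\<^sup>2 + t0 + 1) = u0 ^ 4 + u0 + 1"
    unfolding h_add h_power h_t0 l.square_add
    by (simp add: l.add_self_left l.two_eq_0 algebra_simps flip: power_mult)
  ultimately show "trace (u0 ^ 5) = t0\<^sup>2 + t0 + 1" by (metis h_eq_iff)
qed

text \<open>Transitivity of the trace leaves correction terms in \<open>t0\<close> and
  \<open>t0\<^sup>2\<close>. Squaring the former inside the trace turns all of them into multiples
  of \<open>t0\<^sup>2\<close>, and they combine to \<open>y^5 P(y)\<close>.\<close>

lemma Q_map_h_u0:
  "l.Q_map (h a) (h b) (h c) (h y * u0) =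
     h (k.Q_map a b c y + k.tr (t0\<^sup>2 * (y ^ 5 * (a\<^sup>2 * y ^ 5 + b\<^sup>2 * y + a))))"
proof -
  have 1: "k.tr (a * y ^ 5 * t0) = k.tr (a\<^sup>2 * y ^ 10 * t0\<^sup>2)"
    using k.tr_square[of "a * y ^ 5 * t0"] by (simp add: power_mult_distrib flip: power_mult)
  have 2: "k.tr (b * y ^ 3 * t0) = k.tr (b\<^sup>2 * y ^ 6 * t0\<^sup>2)"
    using k.tr_square[of "b * y ^ 3 * t0"] by (simp add: power_mult_distrib flip: power_mult)
  have "h a * (h y * u0) ^ 5 + h b * (h y * u0) ^ 3 + h c * (h y * u0) =
      h (a * y ^ 5) * u0 ^ 5 + h (b * y ^ 3) * u0 ^ 3 + h (c * y) * u0"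
    by (simp add: h_mult h_power power_mult_distrib mult_ac)
  then have "l.Q_map (h a) (h b) (h c) (h y * u0) =
      h (k.tr (a * y ^ 5 * (t0\<^sup>2 + t0 + 1) + b * y ^ 3 * (t0 + 1) + c * y))"
    by (simp add: l.Q_map_def tr_eq trace_add trace_h_mult trace_u0_powers)
  also have "a * y ^ 5 * (t0\<^sup>2 + t0 + 1) + b * y ^ 3 * (t0 + 1) + c * y =
      (a * y ^ 5 + b * y ^ 3 + c * y) + (a * y ^ 5 * t0\<^sup>2 + a * y ^ 5 * t0 + b * y ^ 3 * t0)"
    by (simp add: algebra_simps)
  also have "k.tr \<dots> = k.Q_map a b c y +
      k.tr (a * y ^ 5 * t0\<^sup>2 + a\<^sup>2 * y ^ 10 * t0\<^sup>2 + b\<^sup>2 * y ^ 6 * t0\<^sup>2)"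
    unfolding k.tr_add 1 2 k.Q_map_def ..
  also have "a * y ^ 5 * t0\<^sup>2 + a\<^sup>2 * y ^ 10 * t0\<^sup>2 + b\<^sup>2 * y ^ 6 * t0\<^sup>2 =
      t0\<^sup>2 * (y ^ 5 * (a\<^sup>2 * y ^ 5 + b\<^sup>2 * y + a))"
    by (simp add: algebra_simps eval_nat_numeral)
  finally show ?thesis .
qed

lemma chi_Q_map_h_u0:
  assumes "y \<in> E_roots a b"
  shows "chi (l.Q_map (h a) (h b) (h c) (h y * u0)) = eta a b y * chi (k.Q_map a b c y)"
proof -
  define p where "p = a\<^sup>2 * y ^ 5 + b\<^sup>2 * y + a"
  define v where "v = k.tr (t0\<^sup>2 * (y ^ 5 * p))"
  have "y * p * (1 + y ^ 5 * p) = 0"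
    using assms k.E_map_factor[of a b y] by (simp add: k.E_roots_iff p_def)
  then consider "y = 0 \<or> p = 0" | "y \<noteq> 0" "p \<noteq> 0" "y ^ 5 * p = 1"
    by (auto simp: k.add_eq_0_iff)
  then have "chi v = eta a b y"
  proof cases
    case 2
    \<comment> \<open>Here \<open>v\<close> is the trace of \<open>t0\<^sup>2\<close>, which equals
      \<open>k.tr t0 = 1\<close>.\<close>
    then have "v = 1" by (simp add: v_def k.tr_square tr_t0)
    then show ?thesis using 2 by (simp add: eta_def p_def)
  qed (auto simp: v_def eta_def p_def power_0_left)
  moreover have "chi (l.Q_map (h a) (h b) (h c) (h y * u0)) = chi (k.Q_map a b c y + v)"
    by (simp add: Q_map_h_u0 chi_h v_def p_def)
  moreover have "\<dots> = chi (k.Q_map a b c y) * chi v"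
    by (rule k.chi_add[OF k.Q_map_range]) (simp only: v_def k.tr_range)
  ultimately show ?thesis by simp
qed

lemma gauss_eq_weight_sum:
  "l.gauss (h a) (h b) (h c) = 2 ^ m * weight_sum a b c"
proof -
  let ?Q = "l.Q_map (h a) (h b) (h c)"
  have "l.gauss (h a) (h b) (h c) = (\<Sum>(x, y)\<in>UNIV. chi (?Q (h y * u0 + h x)))"
    unfolding l.gauss_def
    by (subst sum.reindex_bij_betw[OF bij_decomposition, symmetric])
      (simp add: case_prod_unfold add.commute)
  also have "\<dots> = (\<Sum>y\<in>UNIV. \<Sum>x\<in>UNIV. chi (?Q (h y * u0 + h x)))"
    by (subst sum.swap) (simp add: sum.cartesian_product)
  \<comment> \<open>The form vanishes on \<open>k\<close>, so only the polar term depends on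
    \<open>x\<close>; as \<open>h y * u0\<close> has trace \<open>y\<close>, the inner sum tests
    whether \<open>y\<close> lies in \<open>W\<close>.\<close>
  also have "\<dots> = (\<Sum>y\<in>UNIV. chi (?Q (h y * u0)) *
      (\<Sum>x\<in>UNIV. chi (k.tr (x ^ 4 * k.E_map a b y))))"
    by (simp add: l.chi_Q_map_add tr_eq trace_h_mult trace_E_map chi_h sum_distrib_left flip: h_power)
  also have "\<dots> = (\<Sum>y\<in>UNIV. if y \<in> E_roots a b then 2 ^ m * chi (?Q (h y * u0)) else 0)"
    by (intro sum.cong refl) (simp add: k.sum_chi_tr_power4 k.E_roots_iff)
  also have "\<dots> = 2 ^ m * (\<Sum>y\<in>E_roots a b. chi (?Q (h y * u0)))"
    by (simp add: sum.If_cases sum_distrib_left)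
  finally show ?thesis unfolding weight_sum_def by (simp add: chi_Q_map_h_u0)
qed

lemma weight_sum_square:
  "(weight_sum a b c)\<^sup>2 =
     (if V_space m (h a) (h b) (h c) = E_roots (h a) (h b)
      then 2 ^ dim2 (E_roots (h a) (h b)) else 0)"
proof -
  let ?W' = "E_roots (h a) (h b)" and ?Q = "l.Q_map (h a) (h b) (h c)"
  have "(\<forall>x\<in>?W'. ?Q x = 0) \<longleftrightarrow> V_space m (h a) (h b) (h c) = ?W'"
    by (auto simp: V_space_def Q_form_def l.Q_map_def)
  moreover have "(2 ^ m * weight_sum a b c)\<^sup>2 =
      (if \<forall>x\<in>?W'. ?Q x = 0 then 2 ^ (2 * m) * int (card ?W') else 0)"
    using l.gauss_square[of "h a" "h b" "h c"] by (simp add: gauss_eq_weight_sum)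
  moreover have "(2 ^ m * weight_sum a b c)\<^sup>2 = 2 ^ (2 * m) * (weight_sum a b c)\<^sup>2"
    by (simp add: power_mult_distrib power_mult mult.commute)
  moreover have "card ?W' = 2 ^ dim2 ?W'"
    by (rule l.card_dim2[OF l.additive_subgroup_E_roots])
  ultimately show ?thesis by (auto split: if_splits)
qed

text \<open>The parameter \<open>c\<close> enters only through the character
  \<open>k.tr (y * c)\<close>, so averaging over \<open>c\<close> leaves the term at
  \<open>y = 0\<close>.\<close>

lemma sum_weight_sum: "(\<Sum>c\<in>UNIV. weight_sum a b c) = 2 ^ m"
proof -
  have "(\<Sum>c\<in>UNIV. weight_sum a b c) =
      (\<Sum>y\<in>E_roots a b. \<Sum>c\<in>UNIV. eta a b y * chi (k.Q_map a b c y))"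
    unfolding weight_sum_def by (rule sum.swap)
  also have "\<dots> = (\<Sum>y\<in>E_roots a b. if y = 0 then 2 ^ m else 0)"
  proof (rule sum.cong[OF refl])
    fix y assume "y \<in> E_roots a b"
    have "chi (k.Q_map a b c y) = chi (k.Q_map a b 0 y) * chi (k.tr (y * c))" for c
      unfolding k.Q_map_linear[of a b c] mult.commute[of c]
      by (intro k.chi_add k.Q_map_range k.tr_range)
    then have "(\<Sum>c\<in>UNIV. eta a b y * chi (k.Q_map a b c y)) =
        eta a b y * (chi (k.Q_map a b 0 y) * (\<Sum>c\<in>UNIV. chi (k.tr (y * c))))"
      unfolding sum_distrib_left by (rule sum.cong[OF refl arg_cong])
    then show "(\<Sum>c\<in>UNIV. eta a b y * chi (k.Q_map a b c y)) = (if y = 0 then 2 ^ m else 0)"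
      by (simp add: k.sum_chi_tr eta_def)
  qed
  also have "\<dots> = 2 ^ m" by (simp add: k.E_roots_iff)
  finally show ?thesis .
qed

lemma ex_weight_sum_nonzero: "\<exists>c. weight_sum a b c \<noteq> 0"
proof (rule ccontr)
  assume "\<nexists>c. weight_sum a b c \<noteq> 0"
  then show False using sum_weight_sum[of a b] by simp
qed

text \<open>The radical is the same for all \<open>c\<close>, so a single \<open>c\<close> with
  nonzero sum determines its order by \<open>weight_sum_square\<close>.\<close>

lemma dim2_E_roots_eq:
  assumes "\<And>c. weight_sum a b c \<in> {0, 2 ^ j, - (2 ^ j)}"
  shows "dim2 (E_roots (h a) (h b)) = 2 * j"
proof -
  obtain c where c: "weight_sum a b c \<noteq> 0" using ex_weight_sum_nonzero by blast
  have "(weight_sum a b c)\<^sup>2 = 2 ^ (2 * j)"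
    using assms[of c] c by (auto simp: power_mult mult.commute)
  then show ?thesis using weight_sum_square[of a b c] c by (auto split: if_splits)
qed

text \<open>The exponential sum equals twice the number of zeros minus the field order, so its sign
  decides between the two admissible coset counts.\<close>

lemma Q_sgn_eq:
  "Q_sgn m (h a) (h b) (h c) = sgn (weight_sum a b c)"
proof (cases "V_space m (h a) (h b) (h c) = E_roots (h a) (h b)")
  case False
  then show ?thesis using weight_sum_square[of a b c] by (simp add: Q_sgn_def)
next
  case True
  let ?W' = "E_roots (h a) (h b)" and ?N = "Q_zeros m (h a) (h b) (h c)"
    and ?S = "weight_sum a b c" and ?d = "quotient_dim2 UNIV (E_roots (h a) (h b))"
  have S2: "?S\<^sup>2 = 2 ^ dim2 ?W'" using weight_sum_square[of a b c] True by simp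
  \<comment> \<open>A divisor of a power of 2 is a power \<open>2 ^ j\<close>; this makes the
    radical of even dimension \<open>2 * j\<close> and yields \<open>n = m - j\<close>.\<close>
  then have "\<bar>?S\<bar> dvd 2 ^ dim2 ?W'" by (metis dvd_triv_left power2_eq_square abs_dvd_iff)
  then obtain j where j: "\<bar>?S\<bar> = 2 ^ j"
    using divides_primepow_weak[of "2::int" "\<bar>?S\<bar>"] by auto
  have "\<bar>?S\<bar>\<^sup>2 = 2 ^ (2 * j)" unfolding j by (simp add: power_mult mult.commute)
  then have dim: "dim2 ?W' = 2 * j" using S2 by simp
  have "2 ^ (2 * m) = 2 ^ (2 * j) * (2::nat) ^ ?d"
    using l.card_quotient_dim2[of UNIV ?W'] l.additive_subgroup_E_roots[of "h a" "h b"]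
      l.card_dim2[of ?W'] dim
    by (simp add: card_l additive_subgroup_def)
  then have md: "2 * m = 2 * j + ?d" by (simp flip: power_add)
  define n where "n = m - j"
  have d: "?d = 2 * n" and m: "m = j + n" using md by (auto simp: n_def)
  have "\<forall>w\<in>?W'. l.Q_map (h a) (h b) (h c) w = 0"
    using True by (auto simp: V_space_def Q_form_def l.Q_map_def)
  then have "?N * 2 ^ (2 * j) = card {x. l.Q_map (h a) (h b) (h c) x = 0}"
    using l.Q_zeros_cosets[of "h a" "h b" "h c"] l.card_dim2[of ?W'] dim
      l.additive_subgroup_E_roots[of "h a" "h b"]
    by (simp add: Q_zeros_def Q_form_def l.Q_map_def)
  then have "int ?N * 2 ^ (2 * j) = int (card {x. l.Q_map (h a) (h b) (h c) x = 0})"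
    by (metis of_nat_mult of_nat_power of_nat_numeral)
  then have "2 * (int ?N * 2 ^ (2 * j)) = 2 ^ (2 * m) + 2 ^ m * ?S"
    using l.gauss_eq_card[of "h a" "h b" "h c"] gauss_eq_weight_sum[of a b c] by linarith
  moreover have pow: "(2::int) ^ (2 * j) = 2 ^ j * 2 ^ j" by (simp add: mult_2 power_add)
  moreover have "(2::int) ^ (2 * m) = 2 ^ (2 * j) * (2 ^ n * 2 ^ n)"
    by (simp add: m distrib_left power_add) (simp add: mult_2 power_add)
  moreover have "(2::int) ^ m = 2 ^ j * 2 ^ n" by (simp add: m power_add)
  ultimately have eq: "2 * int ?N * 2 ^ (2 * j) = 2 ^ (2 * j) * (2 ^ n * 2 ^ n) + 2 ^ j * 2 ^ n * ?S"
    by simp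
  have n1: "(1::nat) \<le> 2 ^ n" by simp
  have sgn_cases: "?S = 2 ^ j \<or> ?S = - (2 ^ j)" using j by linarith
  then show ?thesis
  proof
    assume S: "?S = 2 ^ j"
    have "2 * int ?N * 2 ^ (2 * j) = (2 ^ n * (2 ^ n + 1)) * 2 ^ (2 * j)"
      using eq unfolding S pow by (simp add: algebra_simps)
    then have "2 * int ?N = 2 ^ n * (2 ^ n + 1)" by simp
    then have "int (2 * ?N) = int (2 ^ n * (2 ^ n + 1))" by (simp add: algebra_simps)
    then have "2 * ?N = 2 ^ n * (2 ^ n + 1)" by (simp only: of_nat_eq_iff)
    then show ?thesis using True d S by (auto simp: Q_sgn_def)
  next
    assume S: "?S = - (2 ^ j)"
    have "2 * int ?N * 2 ^ (2 * j) = (2 ^ n * (2 ^ n - 1)) * 2 ^ (2 * j)"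
      using eq unfolding S pow by (simp add: algebra_simps)
    then have "2 * int ?N = 2 ^ n * (2 ^ n - 1)" by simp
    then have "int (2 * ?N) = int (2 ^ n * (2 ^ n - 1))" using n1 by (simp add: of_nat_diff)
    then have N: "2 * ?N = 2 ^ n * (2 ^ n - 1)" by (simp only: of_nat_eq_iff)
    \<comment> \<open>\<open>Q_sgn\<close> tests the plus count first, so that count has to be
      excluded before the minus branch is reached.\<close>
    have "2 ^ n * (2 ^ n - 1) < 2 ^ n * (2 ^ n + (1::nat))"
      by (intro mult_strict_left_mono) auto
    then have "2 * ?N < 2 ^ n * (2 ^ n + 1)" unfolding N .
    then have "\<not> (\<exists>n'. ?d = 2 * n' \<and> 2 * ?N = 2 ^ n' * (2 ^ n' + 1))" using d by auto
    moreover have "\<exists>n'. ?d = 2 * n' \<and> 2 * ?N = 2 ^ n' * (2 ^ n' - 1)" using d N by blast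
    ultimately show ?thesis using True S by (simp add: Q_sgn_def)
  qed
qed

section \<open>The sum over \<open>W\<close> by factorization type\<close>

text \<open>The lower bound comes from the embedding of \<open>W\<close> by \<open>h\<close>, the
  upper one from the nonnegativity of the dimension in \<open>quotient_dim2_U_space\<close>.\<close>

lemma dim2_E_roots_bounds:
  "dim2 (E_roots a b) \<le> dim2 (E_roots (h a) (h b))"
  "dim2 (E_roots (h a) (h b)) \<le> 2 * dim2 (E_roots a b)"
proof -
  have "h ` E_roots a b \<subseteq> E_roots (h a) (h b)" by (auto simp: h_mem_E_roots)
  then have "card (h ` E_roots a b) \<le> card (E_roots (h a) (h b))" by (intro card_mono) auto
  also have "card (h ` E_roots a b) = card (E_roots a b)" by (simp add: card_image inj_on_def)
  finally have "(2::nat) ^ dim2 (E_roots a b) \<le> 2 ^ dim2 (E_roots (h a) (h b))"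
    by (simp add: k.card_dim2 l.card_dim2 k.additive_subgroup_E_roots l.additive_subgroup_E_roots)
  then show "dim2 (E_roots a b) \<le> dim2 (E_roots (h a) (h b))" by simp
  show "dim2 (E_roots (h a) (h b)) \<le> 2 * dim2 (E_roots a b)"
    \<comment> \<open>The last \<open>a\<close> is an arbitrary value for \<open>c\<close>, which
      does not occur in the bound.\<close>
    using quotient_dim2_U_space[of a b a] by linarith
qed

text \<open>
  Excludes the values \<open>2\<close>, \<open>-6\<close> and \<open>-14\<close> below, which would otherwise require relations between
  the character values.
\<close>
lemma weight_sum_square_cases:
  "weight_sum a b c = 0 \<or> (\<exists>e\<in>{dim2 (E_roots a b)..2 * dim2 (E_roots a b)}. (weight_sum a b c)\<^sup>2 = 2 ^ e)"
  using weight_sum_square[of a b c] dim2_E_roots_bounds[of a b] by (auto split: if_splits)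

text \<open>
  The roots of \<open>P\<close> at which the form induced by \<open>\<tilde>Q\<close> on \<open>U / k\<close>, identified with \<open>W\<close> by the trace,
  vanishes.
\<close>
definition zero_roots :: "'k \<Rightarrow> 'k \<Rightarrow> 'k \<Rightarrow> 'k set" where
  "zero_roots a b c = {z \<in> k.P_roots a b. ell m a b c z = k.tr 1}"

context
  fixes a b :: 'k
  assumes a: "a \<noteq> 0"
begin

lemma chi_Q_map_add_E_roots:
  assumes "x \<in> E_roots a b"
  shows "chi (k.Q_map a b c (x + y)) = chi (k.Q_map a b c x) * chi (k.Q_map a b c y)"
  unfolding k.Q_map_add_E_roots[OF assms] by (intro k.chi_add k.Q_map_range)

text \<open>\<open>e\<close> is the character sum over the roots of \<open>P\<close>. Roots carry
  weight 1; sums of two roots carry weight -1 and contribute half of \<open>e^2\<close> minus the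
  number of roots. Doubling clears that half.\<close>

lemma weight_sum_eq:
  fixes c :: 'k
  defines "e \<equiv> 2 * int (card (zero_roots a b c)) - int (card (k.P_roots a b))"
  shows "2 * weight_sum a b c = 2 + 2 * e - e\<^sup>2 + int (card (k.P_roots a b))
    - 2 * (\<Sum>s\<in>k.conj_sums a b. chi (k.Q_map a b c s))"
proof -
  let ?Z = "k.P_roots a b" and ?X = "\<lambda>y. chi (k.Q_map a b c y)"
  have eta_1: "eta a b y = 1" if "y \<in> insert 0 ?Z" for y
    using that by (auto simp: eta_def k.P_roots_iff)
  have eta_m1: "eta a b y = -1" if "y \<in> k.root_sums a b \<union> k.conj_sums a b" for y
    using that k.quadratic_sums_disjoint[OF a, of b] by (auto simp: eta_def k.P_roots_iff)
  have "weight_sum a b c = (\<Sum>y\<in>insert 0 ?Z. eta a b y * ?X y) +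
      (\<Sum>y\<in>k.root_sums a b \<union> k.conj_sums a b. eta a b y * ?X y)"
    unfolding weight_sum_def k.E_roots_eq[OF a]
    using k.quadratic_sums_disjoint[OF a, of b]
    by (subst sum.union_disjoint[symmetric]) auto
  also have "(\<Sum>y\<in>insert 0 ?Z. eta a b y * ?X y) = (\<Sum>y\<in>insert 0 ?Z. ?X y)"
    by (intro sum.cong) (simp_all add: eta_1)
  also have "\<dots> = 1 + (\<Sum>y\<in>?Z. ?X y)"
    using k.zero_notin_P_roots[OF a] by simp
  also have "(\<Sum>y\<in>k.root_sums a b \<union> k.conj_sums a b. eta a b y * ?X y) =
      (\<Sum>y\<in>k.root_sums a b \<union> k.conj_sums a b. - ?X y)"
    by (intro sum.cong) (simp_all add: eta_m1)
  also have "\<dots> = - (\<Sum>y\<in>k.root_sums a b. ?X y) - (\<Sum>y\<in>k.conj_sums a b. ?X y)"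
    using k.root_sums_conj_sums_disjoint[OF a]
    by (subst sum.union_disjoint) (auto simp: sum_negf)
  finally have S: "weight_sum a b c = 1 + (\<Sum>y\<in>?Z. ?X y) - (\<Sum>y\<in>k.root_sums a b. ?X y)
      - (\<Sum>y\<in>k.conj_sums a b. ?X y)" by simp
  have "2 * (\<Sum>y\<in>k.root_sums a b. ?X y) = (\<Sum>y\<in>?Z. ?X y)\<^sup>2 - int (card ?Z)"
    using k.E_roots_eq[OF a]
    by (intro k.sum_root_sums_multiplicative[OF a] chi_Q_map_add_E_roots k.chi_mult_self) auto
  moreover have "(\<Sum>y\<in>?Z. ?X y) = e"
  proof -
    have "?X z = 2 * of_bool (ell m a b c z = k.tr 1) - 1" if "z \<in> ?Z" for z
      using k.Q_map_P_roots[OF a that] by (simp add: chi_def k.add_eq_0_iff)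
    then have "(\<Sum>z\<in>?Z. ?X z) = (\<Sum>z\<in>?Z. 2 * of_bool (ell m a b c z = k.tr 1) - 1)"
      by (intro sum.cong) auto
    also have "\<dots> = e"
      by (simp add: e_def zero_roots_def sum_subtractf Int_def flip: sum_distrib_left)
    finally show ?thesis .
  qed
  ultimately show ?thesis using S by simp
qed

lemma card_zero_roots_le: "card (zero_roots a b c) \<le> card (k.P_roots a b)"
  by (intro card_mono) (auto simp: zero_roots_def)

lemma dim2_from_counts:
  assumes "card (k.P_roots a b) = r" "card (k.conj_sums a b) = i"
    and "2 + r * (r + 1) + 2 * i = 2 * 2 ^ w"
  shows "dim2 (E_roots a b) = w"
proof -
  have "(2::nat) ^ dim2 (E_roots a b) = 2 ^ w"
    using k.card_E_roots[OF a, of b] assms k.card_dim2[OF k.additive_subgroup_E_roots[of a b]]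
    by simp
  then show ?thesis by simp
qed

lemma weight_sum_0_0:
  assumes "card (k.P_roots a b) = 0" "card (k.conj_sums a b) = 0"
  shows "weight_sum a b c = 1"
  using weight_sum_eq[of c] card_zero_roots_le[of c] assms by simp

lemma weight_sum_1_0:
  assumes "card (k.P_roots a b) = 1" "card (k.conj_sums a b) = 0"
  shows "weight_sum a b c \<in> {0, 2}"
proof -
  have "card (zero_roots a b c) = 0 \<or> card (zero_roots a b c) = 1"
    using card_zero_roots_le[of c] assms by linarith
  then show ?thesis using weight_sum_eq[of c] assms by auto
qed

lemma weight_sum_0_1:
  assumes "card (k.P_roots a b) = 0" "card (k.conj_sums a b) = 1"
  shows "weight_sum a b c \<in> {0, 2}"
proof -
  obtain r where "k.conj_sums a b = {r}" using assms(2) by (auto simp: card_1_singleton_iff)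
  then show ?thesis
    using weight_sum_eq[of c] card_zero_roots_le[of c] assms chi_cases[of "k.Q_map a b c r"] by auto
qed

text \<open>The value 2 would pass \<open>weight_sum_square_cases\<close>, so a relation is needed:
  \<open>W\<close> is a group of order 4, hence \<open>z = r + s\<close> and the sum factors as
  \<open>(1 - ?X r) (1 - ?X s)\<close>.\<close>

lemma weight_sum_1_2:
  assumes "card (k.P_roots a b) = 1" "card (k.conj_sums a b) = 2"
  shows "weight_sum a b c \<in> {0, 4}"
proof -
  let ?X = "\<lambda>y. chi (k.Q_map a b c y)"
  obtain z where z: "k.P_roots a b = {z}" using assms(1) by (auto simp: card_1_singleton_iff)
  obtain r s where rs: "k.conj_sums a b = {r, s}" "r \<noteq> s" using assms(2) by (auto simp: card_2_iff)
  have "k.root_sums a b = {}" by (auto simp: k.root_sums_def z)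
  then have W: "E_roots a b = {0, z, r, s}" by (auto simp: k.E_roots_eq[OF a] z rs)
  have "r \<noteq> 0" "s \<noteq> 0" using k.quadratic_sums_disjoint[OF a, of b] rs by auto
  moreover have "r + s \<in> E_roots a b"
    using k.additive_subgroup_E_roots[of a b] W by (auto simp: additive_subgroup_def)
  ultimately have "r + s = z" using W rs(2) k.add_eq_0_iff[of r s] by auto
  then have Xz: "?X z = ?X r * ?X s" using chi_Q_map_add_E_roots[of r c s] W by auto
  have "weight_sum a b c = (\<Sum>y\<in>{0, z, r, s}. eta a b y * ?X y)"
    by (simp add: weight_sum_def W)
  moreover have "eta a b r = -1" "eta a b s = -1" "eta a b z = 1"
    using k.quadratic_sums_disjoint[OF a, of b] z rs by (auto simp: eta_def simp flip: k.P_roots_iff)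
  moreover have "z \<notin> {0, r, s}"
    using k.zero_notin_P_roots[OF a, of b] k.quadratic_sums_disjoint[OF a, of b] z rs by auto
  ultimately have "weight_sum a b c = 1 + ?X r * ?X s - ?X r - ?X s"
    using \<open>r \<noteq> 0\<close> \<open>s \<noteq> 0\<close> rs(2) Xz by (simp add: eta_def)
  then show ?thesis using chi_cases[of "k.Q_map a b c r"] chi_cases[of "k.Q_map a b c s"] by auto
qed

text \<open>For 0, 1, 2 elements of \<open>zero_roots\<close> the formula gives -2, 2, 2.\<close>

lemma weight_sum_2_0:
  assumes "card (k.P_roots a b) = 2" "card (k.conj_sums a b) = 0"
  shows "weight_sum a b c \<in> {2, -2}" "weight_sum a b c = -2 \<longleftrightarrow> zero_roots a b c = {}"
proof -
  have "card (zero_roots a b c) \<in> {0, 1, 2}" using card_zero_roots_le[of c] assms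
    unfolding insert_iff empty_iff by linarith
  then have "weight_sum a b c \<in> {2, -2} \<and>
      (weight_sum a b c = -2 \<longleftrightarrow> card (zero_roots a b c) = 0)"
    using weight_sum_eq[of c] assms by auto
  then show "weight_sum a b c \<in> {2, -2}" "weight_sum a b c = -2 \<longleftrightarrow> zero_roots a b c = {}"
    by auto
qed

text \<open>The formula also allows 2 and -6, but 4 and 36 are not among the squares
  \<open>2 ^ 3\<close> to \<open>2 ^ 6\<close>. The remaining -4 occurs only for empty
  \<open>zero_roots\<close>.\<close>

lemma weight_sum_3_1:
  assumes "card (k.P_roots a b) = 3" "card (k.conj_sums a b) = 1"
  shows "weight_sum a b c \<in> {0, 4, -4}" "weight_sum a b c = -4 \<longleftrightarrow> zero_roots a b c = {}"
proof -
  obtain r where r: "k.conj_sums a b = {r}" using assms(2) by (auto simp: card_1_singleton_iff)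
  have "dim2 (E_roots a b) = 3" by (rule dim2_from_counts[OF assms]) simp
  then have sq: "weight_sum a b c = 0 \<or> (\<exists>e\<in>{3, 4, 5, 6}. (weight_sum a b c)\<^sup>2 = 2 ^ e)"
    using weight_sum_square_cases[of a b c] by (auto simp: atLeastAtMost_iff le_Suc_eq numeral_eq_Suc)
  have "card (zero_roots a b c) \<in> {0, 1, 2, 3}" using card_zero_roots_le[of c] assms
    unfolding insert_iff empty_iff by linarith
  then have "weight_sum a b c \<in> {0, 4, -4} \<and>
      (weight_sum a b c = -4 \<longleftrightarrow> card (zero_roots a b c) = 0)"
    using weight_sum_eq[of c] assms sq chi_cases[of "k.Q_map a b c r"] by (auto simp: r)
  then show "weight_sum a b c \<in> {0, 4, -4}" "weight_sum a b c = -4 \<longleftrightarrow> zero_roots a b c = {}"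
    by auto
qed

text \<open>For 0 to 5 elements of \<open>zero_roots\<close> the formula gives -14, -4, 2, 4, 2, -4.
  The squares 196 and 4 are not among \<open>2 ^ 4\<close> to \<open>2 ^ 8\<close>, so the even
  counts drop out.\<close>

lemma weight_sum_5_0:
  assumes "card (k.P_roots a b) = 5" "card (k.conj_sums a b) = 0"
  shows "weight_sum a b c \<in> {4, -4}" "weight_sum a b c = 4 \<longleftrightarrow> card (zero_roots a b c) = 3"
    "zero_roots a b c \<noteq> {}"
proof -
  have "dim2 (E_roots a b) = 4" by (rule dim2_from_counts[OF assms]) simp
  then have sq: "weight_sum a b c = 0 \<or> (\<exists>e\<in>{4, 5, 6, 7, 8}. (weight_sum a b c)\<^sup>2 = 2 ^ e)"
    using weight_sum_square_cases[of a b c] by (auto simp: atLeastAtMost_iff le_Suc_eq numeral_eq_Suc)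
  have "card (zero_roots a b c) \<in> {0, 1, 2, 3, 4, 5}" using card_zero_roots_le[of c] assms
    unfolding insert_iff empty_iff by linarith
  then have "weight_sum a b c \<in> {4, -4} \<and>
      (weight_sum a b c = 4 \<longleftrightarrow> card (zero_roots a b c) = 3) \<and> card (zero_roots a b c) \<noteq> 0"
    using weight_sum_eq[of c] assms sq by auto
  then show "weight_sum a b c \<in> {4, -4}" "weight_sum a b c = 4 \<longleftrightarrow> card (zero_roots a b c) = 3"
    "zero_roots a b c \<noteq> {}" by auto
qed

text \<open>
  For the \<open>c\<close> with \<open>\<ell>\<^sub>c = 0\<close> the set \<open>zero_roots\<close> is empty unless \<open>Tr(1) = 0\<close>. This is why the last
  condition of the theorem can be phrased with \<open>\<ell>\<^sub>c(z) = 0\<close> instead of \<open>\<ell>\<^sub>c(z) = Tr(1)\<close>.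
\<close>
lemma tr_1_eq_0:
  assumes "card (k.P_roots a b) = 5" "card (k.conj_sums a b) = 0"
  shows "k.tr 1 = 0"
proof -
  have "ell m a b (b\<^sup>2 * inverse a) z = 0" for z
    by (simp only: ell_def k.add_self mult_zero_left k.tr_0)
  then show ?thesis
    using weight_sum_5_0(3)[OF assms, of "b\<^sup>2 * inverse a"] by (auto simp: zero_roots_def)
qed

end

end

theorem theorem3p5:
  fixes h :: "'k::{field,finite} \<Rightarrow> 'l::{field,finite}"
    and m :: nat and a b c :: 'k
  assumes "m \<ge> 1"
    and "CARD('k) = 2 ^ m"
    and "CARD('l) = (2 ^ m) ^ 2"
    and "field_embedding h"
    and "a \<noteq> 0"
  shows
    "let P = P_poly a b;
         W = E_roots a b;
         W' = E_roots (h a) (h b);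
         w = dim2 W;
         w' = dim2 W';
         kW' = {h x + v | x v. v \<in> W'};
         u = quotient_dim2 (U_space h m a b c) kW';
         s = Q_sgn m (h a) (h b) (h c);
         Z = {x. poly P x = 0}
     in
       (irreducible P \<longrightarrow>
          w = 0 \<and> w' = 0 \<and> u = 0 \<and> s = 1) \<and>
       (has_factor_type P {#1, 4#} \<or> has_factor_type P {#2, 3#} \<longrightarrow>
          w = 1 \<and> w' = 2 \<and> u = 0 \<and> s \<in> {0, 1}) \<and>
       (has_factor_type P {#1, 1, 3#} \<longrightarrow>
          w = 2 \<and> w' = 2 \<and> u = 2 \<and> s \<in> {1, -1}) \<and>
       (has_factor_type P {#1, 2, 2#} \<longrightarrow>
          w = 2 \<and> w' = 4 \<and> u = 0 \<and> s \<in> {0, 1}) \<and>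
       (has_factor_type P {#1, 1, 1, 2#} \<longrightarrow>
          w = 3 \<and> w' = 4 \<and> u = 2 \<and> s \<in> {0, 1, -1}) \<and>
       (has_factor_type P {#1, 1, 1, 1, 1#} \<longrightarrow>
          w = 4 \<and> w' = 4 \<and> u = 4 \<and> s \<in> {1, -1}) \<and>
       Z \<subseteq> W \<and>
       (has_factor_type P {#1, 1, 3#} \<or> has_factor_type P {#1, 1, 1, 2#} \<longrightarrow>
          (s = -1 \<longleftrightarrow> (\<forall>z\<in>Z. ell m a b c z \<noteq> abs_trace m 1))) \<and>
       (has_factor_type P {#1, 1, 1, 1, 1#} \<longrightarrow>
          (s = 1 \<longleftrightarrow> card {z \<in> Z. ell m a b c z = 0} = 3))"
proof -
  interpret quadratic_extension h m
    using assms by unfold_locales (simp_all add: mult.commute flip: power_mult)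
  let ?P = "P_poly a b" and ?w = "dim2 (E_roots a b)" and ?w' = "dim2 (E_roots (h a) (h b))"
    and ?u = "quotient_dim2 (U_space h m a b c) {h x + v | x v. v \<in> E_roots (h a) (h b)}"
    and ?s = "Q_sgn m (h a) (h b) (h c)" and ?Z = "{x. poly (P_poly a b) x = 0}"
  have Z: "?Z = k.P_roots a b" by (simp add: k.P_roots_def)
  have u: "?u + ?w' = 2 * ?w" by (rule quotient_dim2_U_space)
  note counts = k.has_factor_type_counts[OF \<open>a \<noteq> 0\<close>]
  note w = dim2_from_counts[OF \<open>a \<noteq> 0\<close> counts]
  have zero: "zero_roots a b c = {} \<longleftrightarrow> (\<forall>z\<in>?Z. ell m a b c z \<noteq> abs_trace m 1)"
    unfolding Z by (auto simp: zero_roots_def)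
  have irred: "?w = 0 \<and> ?w' = 0 \<and> ?u = 0 \<and> ?s = 1" if "irreducible ?P"
  proof -
    have ft: "has_factor_type ?P {#5#}"
      unfolding has_factor_type_def using that degree_P_poly[OF \<open>a \<noteq> 0\<close>, of b]
      by (intro exI[of _ "{#?P#}"]) simp
    have S: "weight_sum a b c = 1" for c
      using weight_sum_0_0[OF \<open>a \<noteq> 0\<close>] counts[OF ft] by simp
    have "?w = 0" by (rule w[OF ft ft]) simp
    \<comment> \<open>The product form exhibits the exponent \<open>j\<close> of the absolute value
      \<open>2 ^ j\<close> of the nonzero sums, here \<open>j = 0\<close>; likewise in the other
      cases.\<close>
    moreover have "?w' = 2 * 0" by (rule dim2_E_roots_eq) (simp add: S)
    ultimately show ?thesis using u by (simp add: Q_sgn_eq S)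
  qed
  have t14: "?w = 1 \<and> ?w' = 2 \<and> ?u = 0 \<and> ?s \<in> {0, 1}"
    if ft: "has_factor_type ?P {#1, 4#} \<or> has_factor_type ?P {#2, 3#}"
  proof -
    have S: "weight_sum a b c \<in> {0, 2}" for c
      using ft weight_sum_1_0[OF \<open>a \<noteq> 0\<close>] weight_sum_0_1[OF \<open>a \<noteq> 0\<close>] counts by fastforce
    have "?w = 1" using ft w by fastforce
    moreover have "?w' = 2 * 1" by (rule dim2_E_roots_eq) (use S in auto)
    ultimately show ?thesis using u S[of c] by (auto simp: Q_sgn_eq)
  qed
  have t113: "?w = 2 \<and> ?w' = 2 \<and> ?u = 2 \<and> ?s \<in> {1, -1} \<and> (?s = -1 \<longleftrightarrow> zero_roots a b c = {})"
    if ft: "has_factor_type ?P {#1, 1, 3#}"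
  proof -
    have r: "card (k.P_roots a b) = 2" "card (k.conj_sums a b) = 0" using counts[OF ft] by simp_all
    note S = weight_sum_2_0[OF \<open>a \<noteq> 0\<close> r]
    have "?w = 2" by (rule dim2_from_counts[OF \<open>a \<noteq> 0\<close> r]) simp
    moreover have "?w' = 2 * 1" by (rule dim2_E_roots_eq) (use S in auto)
    ultimately show ?thesis using u S[of c] by (auto simp: Q_sgn_eq)
  qed
  have t122: "?w = 2 \<and> ?w' = 4 \<and> ?u = 0 \<and> ?s \<in> {0, 1}"
    if ft: "has_factor_type ?P {#1, 2, 2#}"
  proof -
    have r: "card (k.P_roots a b) = 1" "card (k.conj_sums a b) = 2" using counts[OF ft] by simp_all
    note S = weight_sum_1_2[OF \<open>a \<noteq> 0\<close> r]
    have "?w = 2" by (rule dim2_from_counts[OF \<open>a \<noteq> 0\<close> r]) simp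
    moreover have "?w' = 2 * 2" by (rule dim2_E_roots_eq) (use S in auto)
    ultimately show ?thesis using u S[of c] by (auto simp: Q_sgn_eq)
  qed
  have t1112: "?w = 3 \<and> ?w' = 4 \<and> ?u = 2 \<and> ?s \<in> {0, 1, -1} \<and> (?s = -1 \<longleftrightarrow> zero_roots a b c = {})"
    if ft: "has_factor_type ?P {#1, 1, 1, 2#}"
  proof -
    have r: "card (k.P_roots a b) = 3" "card (k.conj_sums a b) = 1" using counts[OF ft] by simp_all
    note S = weight_sum_3_1[OF \<open>a \<noteq> 0\<close> r]
    have "?w = 3" by (rule dim2_from_counts[OF \<open>a \<noteq> 0\<close> r]) simp
    moreover have "?w' = 2 * 2" by (rule dim2_E_roots_eq) (use S in auto)
    ultimately show ?thesis using u S[of c] by (auto simp: Q_sgn_eq)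
  qed
  have t11111: "?w = 4 \<and> ?w' = 4 \<and> ?u = 4 \<and> ?s \<in> {1, -1} \<and>
      (?s = 1 \<longleftrightarrow> card {z \<in> ?Z. ell m a b c z = 0} = 3)"
    if ft: "has_factor_type ?P {#1, 1, 1, 1, 1#}"
  proof -
    have r: "card (k.P_roots a b) = 5" "card (k.conj_sums a b) = 0" using counts[OF ft] by simp_all
    note S = weight_sum_5_0[OF \<open>a \<noteq> 0\<close> r]
    have "?w = 4" by (rule dim2_from_counts[OF \<open>a \<noteq> 0\<close> r]) simp
    moreover have "?w' = 2 * 2" by (rule dim2_E_roots_eq) (use S in auto)
    moreover have "zero_roots a b c = {z \<in> ?Z. ell m a b c z = 0}"
      unfolding Z zero_roots_def tr_1_eq_0[OF \<open>a \<noteq> 0\<close> r] ..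
    ultimately show ?thesis using u S[of c] by (auto simp: Q_sgn_eq)
  qed
  have "?Z \<subseteq> E_roots a b" unfolding Z using k.E_roots_eq[OF \<open>a \<noteq> 0\<close>, of b] by blast
  then show ?thesis
    unfolding Let_def using irred t14 t113 t122 t1112 t11111 zero by blast
qed

end
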